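(* Fix $r,N\ge 1$, a partition $\lambda=(\lambda_1\ge\dots\ge\lambda_r\ge 0)$ with $\lambda_1<N$, and $w_3,w_4\in S_r$. For $w_1,w_2\in S_r$ let $Z(w_1,w_2;\mathbf z)$ be the partition function of the system $\mathcal S(\lambda,w_1,w_2,w_3,w_4,\mathbf z)$ of the bicolored bosonic model. For $1\le i\le r-1$ let $s_i=(i,i+1)$ act on functions of $\mathbf z$ by $(s_if)(\mathbf z)=f(s_i\mathbf z)$ (interchanging $z_i$ and $z_{i+1}$), and define the operators on functions of $\mathbf z$ $$D^{(1)}_i=(z_i-z_{i+1})^{-1}(z_i-z_is_i),\qquad D^{(2)}_i=(z_i-z_{i+1})^{-1}(z_i-z_{i+1}s_i),$$ $$D^{(3)}_i=(z_i-z_{i+1})^{-1}(z_{i+1}-z_is_i),\qquad D^{(4)}_i=(z_i-z_{i+1})^{-1}(z_{i+1}-z_{i+1}s_i).$$ Then $(D^{(1)}_i)^2=D^{(1)}_i$, $(D^{(2)}_i)^2=D^{(2)}_i$, $(D^{(3)}_i)^2=-D^{(3)}_i$, $(D^{(4)}_i)^2=-D^{(4)}_i$, and $$D^{(1)}_iD^{(2)}_i=D^{(1)}_iD^{(3)}_i=D^{(2)}_iD^{(4)}_i=D^{(3)}_iD^{(1)}_i=D^{(4)}_iD^{(2)}_i=D^{(4)}_iD^{(3)}_i=0.$$ Moreover, for all $w_1,w_2\in S_r$ (with $<$ the Bruhat order): $$\begin{aligned} D^{(1)}_iZ(w_1,w_2;\mathbf z)&=(1-t)^{-1}\big(Z(s_iw_1,w_2;s_i\mathbf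 z)-Z(w_1,s_iw_2;\mathbf z)\big)&&\text{if }s_iw_1<w_1,\ s_iw_2<w_2,\\ D^{(2)}_iZ(w_1,w_2;\mathbf z)&=(1-t)^{-1}\big(tZ(s_iw_1,w_2;s_i\mathbf z)-Z(w_1,s_iw_2;\mathbf z)\big)&&\text{if }s_iw_1>w_1,\ s_iw_2<w_2,\\ D^{(3)}_iZ(w_1,w_2;\mathbf z)&=(1-t)^{-1}\big(Z(s_iw_1,w_2;s_i\mathbf z)-tZ(w_1,s_iw_2;\mathbf z)\big)&&\text{if }s_iw_1<w_1,\ s_iw_2>w_2,\\ D^{(4)}_iZ(w_1,w_2;\mathbf z)&=(1-t)^{-1}\big(tZ(s_iw_1,w_2;s_i\mathbf z)-tZ(w_1,s_iw_2;\mathbf z)\big)&&\text{if }s_iw_1>w_1,\ s_iw_2>w_2. \end{aligned}$$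
   Context: Colors are $c_1<\dots<c_r$ and dolors are $d_1<\dots<d_r$; $w_0\in S_r$ is the long element. $t$ and $z_1,\dots,z_r$ are treated as indeterminates; operators act on rational functions in $z_1,\dots,z_r$ (over $\mathbb Q(t)$). Unfused vertices. An unfused vertex carries a color-dolor label $(c,d)$ and a parameter $z$. Its left and right (horizontal) edges each carry exactly one element of $\{c_i\}\cup\{d_i\}$; its top and bottom (vertical) edges each carry a number in $\mathbb N=\{0,1,2,\dots\}$ (the number of bosons, i.e. pairs, of type $(c,d)$). The admissible configurations and weights are: (1) left $=$ right $=x$ a dolor, top $=$ bottom $=n$: weight $1$ if $x=d$; if $x\ne d$, weight $z^{\epsilon}t^{\eta}$ with $\epsilon=1$ if $c=c_1$, else $0$, and $\eta=n$ if $x<d$, else $0$. (2) left $=$ right $=a$ a color, top $=$ bottom $=n$: weight $z$ if $a=c$; $t^n$ if $c>a$; $1$ if $c<a$. (3) left $=d$, right $=c$, top $=n\ge1$, bottom $=n-1$: weight $(1-t^n)/(1-t)=1+t+\dots+t^{n-1}$. (4) left $=c$, right $=d$, top $=n$, bottom $=n+1$: weight $(1-t)z$. All other configurations are inadmissible (weight $0$). Fused vertices. Order color-dolor pairs by: $(c,d)<(c',d')$ iff $d>d'$, or $d=d'$ and $c<c'$. A fused vertex with parameter $z$ is a horizontal row of $r^2$ unfused vertices with parameter $z$, one for each pair $(c,d)$, placed left to right in increasing order. A vertical edge of a fused vertex carries an element of $\mathbb N^{r^2}$ (the multiplicity of each pair); its two horizontal edges carry a color or dolor. A labelling of the four outer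 edges is admissible if the internal horizontal edges can be labelled so that all the unfused vertices are admissible (that labelling is then unique); the weight is the product of the unfused weights. Systems. $\mathcal S(\lambda,w_1,w_2,w_3,w_4,\mathbf z)$ lives on a grid with $r$ rows (numbered $1,\dots,r$ from top to bottom, all vertices of row $i$ having parameter $z_i$) and $N$ columns (numbered $N-1,\dots,0$ from left to right). Boundary conditions: the right boundary edge of row $i$ carries the color $c_{w_1^{-1}(i)}$; the left boundary edge of row $i$ carries the dolor $d_{w_2^{-1}(i)}$; the top boundary carries, for each $i=1,\dots,r$, one boson $(c_{w_3^{-1}(i)},d_{w_4^{-1}w_0(i)})$ in column $\lambda_i$ and nothing else; the bottom boundary is empty. A state is an assignment of spins to all edges compatible with the boundary such that every fused vertex is admissible. The weight of a state is the product of the weights of its fused vertices, and the partition function $Z$ is the sum of the weights of all states. *)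

theory Defs
  imports
    Complex_Main
    "HOL-Library.FuncSet"
    "HOL-Library.Poly_Mapping"
    "HOL-Computational_Algebra.Polynomial"
    "HOL-Computational_Algebra.Fraction_Field"
    "HOL-Combinatorics.Permutations"
begin

section \<open>The symmetric group and its Bruhat order\<close>

text \<open>
  Elements of \<open>S\<^sub>r\<close> are the functions \<open>w :: nat \<Rightarrow> nat\<close> with \<open>w permutes {1..r}\<close>;
  the product \<open>u w\<close> is the composition \<open>u \<circ> w\<close>.
\<close>

abbreviation simple_refl :: "nat \<Rightarrow> nat \<Rightarrow> nat" where
  "simple_refl i \<equiv> transpose i (Suc i)"

definition long_elt :: "nat \<Rightarrow> nat \<Rightarrow> nat" where
  "long_elt r k = (if k \<in> {1..r} then r + 1 - k else k)"

definition coxeter_length :: "nat \<Rightarrow> (nat \<Rightarrow> nat) \<Rightarrow> nat" where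
  "coxeter_length r w =
     (LEAST n. \<exists>js. length js = n \<and> set js \<subseteq> {1..<r} \<and> w = foldr (\<lambda>j u. simple_refl j \<circ> u) js id)"

text \<open>
  The reflections of \<open>S\<^sub>r\<close> are the transpositions. The strict Bruhat order is the transitive
  closure of the relation \<open>u \<rightarrow> t u\<close>, where \<open>t\<close> is a reflection that increases the length.
\<close>

definition bruhat_step :: "nat \<Rightarrow> (nat \<Rightarrow> nat) \<Rightarrow> (nat \<Rightarrow> nat) \<Rightarrow> bool" where
  "bruhat_step r u w \<longleftrightarrow>
     u permutes {1..r} \<and>
     (\<exists>a b. 1 \<le> a \<and> a < b \<and> b \<le> r \<and> w = transpose a b \<circ> u) \<and>
     coxeter_length r u < coxeter_length r w"

definition bruhat_less :: "nat \<Rightarrow> (nat \<Rightarrow> nat) \<Rightarrow> (nat \<Rightarrow> nat) \<Rightarrow> bool" where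
  "bruhat_less r = (bruhat_step r)\<^sup>+\<^sup>+"


section \<open>Unfused vertices\<close>

text \<open>The spin \<open>Color a\<close> is the color \<open>c\<^sub>a\<close> and \<open>Dolor b\<close> is the dolor \<open>d\<^sub>b\<close>, with \<open>1 \<le> a, b \<le> r\<close>.\<close>

datatype spin = Color nat | Dolor nat

definition spins :: "nat \<Rightarrow> spin set" where
  "spins r = Color ` {1..r} \<union> Dolor ` {1..r}"

text \<open>
  A vertex of label \<open>(c, d)\<close> is given by its edges in the order left, top, right, bottom.
\<close>

fun unfused_admissible :: "nat \<times> nat \<Rightarrow> spin \<Rightarrow> nat \<Rightarrow> spin \<Rightarrow> nat \<Rightarrow> bool" where
  "unfused_admissible (c, d) (Dolor x) n (Dolor y) m \<longleftrightarrow> x = y \<and> n = m"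
| "unfused_admissible (c, d) (Color a) n (Color b) m \<longleftrightarrow> a = b \<and> n = m"
| "unfused_admissible (c, d) (Dolor x) n (Color a) m \<longleftrightarrow> x = d \<and> a = c \<and> n \<ge> 1 \<and> m = n - 1"
| "unfused_admissible (c, d) (Color a) n (Dolor x) m \<longleftrightarrow> a = c \<and> x = d \<and> m = n + 1"

text \<open>
  Weight of an admissible configuration; the value is irrelevant for inadmissible ones.
  The quotient \<open>(1 - t^n) / (1 - t)\<close> is written as \<open>1 + t + \<dots> + t^(n-1)\<close>, so that the
  weights make sense in every commutative ring.
\<close>

fun unfused_weight ::
  "'a::comm_ring_1 \<Rightarrow> 'a \<Rightarrow> nat \<times> nat \<Rightarrow> spin \<Rightarrow> nat \<Rightarrow> spin \<Rightarrow> nat \<Rightarrow> 'a" where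
  "unfused_weight t z (c, d) (Dolor x) n (Dolor y) m =
     (if x = d then 1 else z ^ (if c = 1 then 1 else 0) * t ^ (if x < d then n else 0))"
| "unfused_weight t z (c, d) (Color a) n (Color b) m =
     (if a = c then z else if c > a then t ^ n else 1)"
| "unfused_weight t z (c, d) (Dolor x) n (Color a) m = (\<Sum>k<n. t ^ k)"
| "unfused_weight t z (c, d) (Color a) n (Dolor x) m = (1 - t) * z"


section \<open>Fused vertices\<close>

definition pair_less :: "nat \<times> nat \<Rightarrow> nat \<times> nat \<Rightarrow> bool" where
  "pair_less = (\<lambda>(c, d) (c', d'). d > d' \<or> d = d' \<and> c < c')"

definition color_dolor_pairs :: "nat \<Rightarrow> (nat \<times> nat) list" where
  "color_dolor_pairs r = [(c, d). d \<leftarrow> rev [1..<r + 1], c \<leftarrow> [1..<r + 1]]"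

lemma set_color_dolor_pairs: "set (color_dolor_pairs r) = {1..r} \<times> {1..r}"
  by (fastforce simp: color_dolor_pairs_def simp del: upt_Suc)

lemma length_color_dolor_pairs: "length (color_dolor_pairs r) = r\<^sup>2"
  by (simp add: color_dolor_pairs_def length_concat comp_def sum_list_triv power2_eq_square
      flip: rev_map)

lemma sorted_color_dolor_pairs: "sorted_wrt pair_less (color_dolor_pairs r)"
proof -
  have "sorted_wrt pair_less (concat (map (\<lambda>d. map (\<lambda>c. (c, d)) cs) ds))"
    if "sorted_wrt (>) ds" "sorted_wrt (<) cs" for cs ds :: "nat list"
    using that
    by (induction ds) (auto simp: sorted_wrt_append sorted_wrt_map pair_less_def)
  moreover have "sorted_wrt (>) (rev [1..<r + 1])"
    by (simp only: sorted_wrt_rev sorted_wrt_upt)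
  ultimately show ?thesis
    unfolding color_dolor_pairs_def by (auto simp del: upt_Suc)
qed

text \<open>
  The spin \<open>e k\<close> is carried by the horizontal edge to the left of the \<open>k\<close>-th unfused vertex
  (counted from 0) and \<open>e (k + 1)\<close> by the edge to its right. The vertical edges \<open>T\<close>, \<open>B\<close>
  of a fused vertex give the multiplicity of every color-dolor pair.
\<close>

definition internal_labellings ::
  "nat \<Rightarrow> spin \<Rightarrow> (nat \<times> nat \<Rightarrow> nat) \<Rightarrow> spin \<Rightarrow> (nat \<times> nat \<Rightarrow> nat) \<Rightarrow> (nat \<Rightarrow> spin) set" where
  "internal_labellings r left T right B =
     {e \<in> {0..r\<^sup>2} \<rightarrow>\<^sub>E spins r. e 0 = left \<and> e (r\<^sup>2) = right \<and>
        (\<forall>k<r\<^sup>2. let p = color_dolor_pairs r ! k in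
           unfused_admissible p (e k) (T p) (e (Suc k)) (B p))}"

definition fused_admissible ::
  "nat \<Rightarrow> spin \<Rightarrow> (nat \<times> nat \<Rightarrow> nat) \<Rightarrow> spin \<Rightarrow> (nat \<times> nat \<Rightarrow> nat) \<Rightarrow> bool" where
  "fused_admissible r left T right B \<longleftrightarrow> internal_labellings r left T right B \<noteq> {}"

lemma unfused_admissible_right_unique:
  assumes "unfused_admissible p x n y m" "unfused_admissible p x n y' m"
  shows "y = y'"
  using assms by (cases p; cases x; cases y; cases y') auto

lemma internal_labellings_unique:
  assumes e: "e \<in> internal_labellings r left T right B"
    and e': "e' \<in> internal_labellings r left T right B"
  shows "e = e'"
proof -
  have "k \<le> r\<^sup>2 \<longrightarrow> e k = e' k" for k
  proof (induction k)
    case 0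
    show ?case using e e' by (auto simp: internal_labellings_def)
  next
    case (Suc k)
    show ?case
    proof
      assume k: "Suc k \<le> r\<^sup>2"
      define p where "p = color_dolor_pairs r ! k"
      have "unfused_admissible p (e k) (T p) (e (Suc k)) (B p)"
        using e k by (auto simp: internal_labellings_def Let_def p_def)
      moreover have "unfused_admissible p (e' k) (T p) (e' (Suc k)) (B p)"
        using e' k by (auto simp: internal_labellings_def Let_def p_def)
      moreover have "e k = e' k" using Suc k by simp
      ultimately show "e (Suc k) = e' (Suc k)"
        using unfused_admissible_right_unique by metis
    qed
  qed
  moreover have "e \<in> extensional {0..r\<^sup>2}" "e' \<in> extensional {0..r\<^sup>2}"
    using e e' by (auto simp: internal_labellings_def PiE_def)
  ultimately show ?thesis
    by (intro extensionalityI[of e "{0..r\<^sup>2}" e']) auto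
qed

text \<open>
  For an admissible configuration the sum has exactly one term, by
  \<open>internal_labellings_unique\<close>.
\<close>

definition fused_weight ::
  "nat \<Rightarrow> 'a::comm_ring_1 \<Rightarrow> 'a \<Rightarrow> spin \<Rightarrow> (nat \<times> nat \<Rightarrow> nat) \<Rightarrow> spin \<Rightarrow> (nat \<times> nat \<Rightarrow> nat) \<Rightarrow> 'a" where
  "fused_weight r t z left T right B =
     (\<Sum>e \<in> internal_labellings r left T right B. \<Prod>k<r\<^sup>2.
        let p = color_dolor_pairs r ! k in unfused_weight t z p (e k) (T p) (e (Suc k)) (B p))"


section \<open>The systems and their partition functions\<close>

definition boson_labels :: "nat \<Rightarrow> (nat \<times> nat \<Rightarrow> nat) set" where
  "boson_labels r = {m. \<forall>p. p \<notin> {1..r} \<times> {1..r} \<longrightarrow> m p = 0}"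

definition top_boundary ::
  "nat \<Rightarrow> (nat \<Rightarrow> nat) \<Rightarrow> (nat \<Rightarrow> nat) \<Rightarrow> (nat \<Rightarrow> nat) \<Rightarrow> nat \<Rightarrow> (nat \<times> nat \<Rightarrow> nat)" where
  "top_boundary r lam w3 w4 j =
     (\<lambda>p. card {k \<in> {1..r}. lam k = j \<and> p = (inv w3 k, inv w4 (long_elt r k))})"

text \<open>
  A state is a pair \<open>(h, v)\<close>. For a row \<open>1 \<le> i \<le> r\<close> and a column \<open>j < N\<close>, columns being numbered
  from right to left, the vertex at \<open>(i, j)\<close> has left edge \<open>h i (j + 1)\<close>, right edge \<open>h i j\<close>,
  top edge \<open>v (i - 1) j\<close> and bottom edge \<open>v i j\<close>.
  There are only finitely many states: the top boundary is fixed, and at an admissible vertex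
  the multiplicities on the top and bottom edges differ by at most 1.
\<close>

definition states ::
  "nat \<Rightarrow> nat \<Rightarrow> (nat \<Rightarrow> nat) \<Rightarrow> (nat \<Rightarrow> nat) \<Rightarrow> (nat \<Rightarrow> nat) \<Rightarrow> (nat \<Rightarrow> nat) \<Rightarrow> (nat \<Rightarrow> nat) \<Rightarrow>
   ((nat \<Rightarrow> nat \<Rightarrow> spin) \<times> (nat \<Rightarrow> nat \<Rightarrow> nat \<times> nat \<Rightarrow> nat)) set" where
  "states r N lam w1 w2 w3 w4 =
     {(h, v).
        h \<in> {1..r} \<rightarrow>\<^sub>E ({0..N} \<rightarrow>\<^sub>E spins r) \<and>
        v \<in> {0..r} \<rightarrow>\<^sub>E ({0..<N} \<rightarrow>\<^sub>E boson_labels r) \<and>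
        (\<forall>i\<in>{1..r}. h i N = Dolor (inv w2 i) \<and> h i 0 = Color (inv w1 i)) \<and>
        (\<forall>j<N. v 0 j = top_boundary r lam w3 w4 j \<and> v r j = (\<lambda>_. 0)) \<and>
        (\<forall>i\<in>{1..r}. \<forall>j<N. fused_admissible r (h i (j + 1)) (v (i - 1) j) (h i j) (v i j))}"

definition partition_function ::
  "nat \<Rightarrow> nat \<Rightarrow> (nat \<Rightarrow> nat) \<Rightarrow> (nat \<Rightarrow> nat) \<Rightarrow> (nat \<Rightarrow> nat) \<Rightarrow> (nat \<Rightarrow> nat) \<Rightarrow> (nat \<Rightarrow> nat) \<Rightarrow>
   'a::comm_ring_1 \<Rightarrow> (nat \<Rightarrow> 'a) \<Rightarrow> 'a" where
  "partition_function r N lam w1 w2 w3 w4 t z =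
     (\<Sum>(h, v) \<in> states r N lam w1 w2 w3 w4. \<Prod>i\<in>{1..r}. \<Prod>j<N.
        fused_weight r t (z i) (h i (j + 1)) (v (i - 1) j) (h i j) (v i j))"


section \<open>Rational functions in the spectral parameters\<close>

text \<open>
  The field \<open>\<rat>(t)\<close> is \<open>rat poly fract\<close>, and \<open>ratfun\<close> is the field of fractions of the ring of
  polynomials over it in the indeterminates \<open>z\<^sub>0, z\<^sub>1, z\<^sub>2, \<dots>\<close>: monomials are finitely supported
  exponent vectors \<open>nat \<Rightarrow>\<^sub>0 nat\<close>. It contains \<open>\<rat>(t)(z\<^sub>1, \<dots>, z\<^sub>r)\<close> for all \<open>r\<close>, and each of its
  elements involves only finitely many indeterminates.
\<close>

type_synonym zpoly = "(nat \<Rightarrow>\<^sub>0 nat) \<Rightarrow>\<^sub>0 rat poly fract"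
type_synonym ratfun = "zpoly fract"

definition t_ind :: ratfun where
  "t_ind = Fract (Poly_Mapping.single 0 (Fract [:0, 1:] 1)) 1"

definition z_ind :: "nat \<Rightarrow> ratfun" where
  "z_ind i = Fract (Poly_Mapping.single (Poly_Mapping.single i 1) 1) 1"

text \<open>
  Since \<open>map_key\<close> precomposes and \<open>simple_refl i\<close> is an involution, \<open>swap_poly i p\<close> is \<open>p\<close> with
  \<open>z\<^sub>i\<close> and \<open>z\<^sub>i\<^sub>+\<^sub>1\<close> interchanged.
\<close>

definition swap_monom :: "nat \<Rightarrow> (nat \<Rightarrow>\<^sub>0 nat) \<Rightarrow> (nat \<Rightarrow>\<^sub>0 nat)" where
  "swap_monom i = Poly_Mapping.map_key (simple_refl i)"

definition swap_poly :: "nat \<Rightarrow> zpoly \<Rightarrow> zpoly" where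
  "swap_poly i = Poly_Mapping.map_key (swap_monom i)"

lemma inj_simple_refl: "inj (simple_refl i)"
  by (metis injI transpose_involutory)

lemma swap_monom_swap_monom [simp]: "swap_monom i (swap_monom i m) = m"
  by (simp add: swap_monom_def map_key_compose inj_simple_refl transpose_comp_involutory id_def
      map_key_id)

lemma inj_swap_monom: "inj (swap_monom i)"
  by (metis injI swap_monom_swap_monom)

lemma swap_monom_add: "swap_monom i (m + n) = swap_monom i m + swap_monom i n"
  by (simp add: swap_monom_def map_key_plus inj_simple_refl)

lemma swap_poly_swap_poly [simp]: "swap_poly i (swap_poly i p) = p"
proof -
  have "swap_monom i \<circ> swap_monom i = (\<lambda>x. x)" by (simp add: fun_eq_iff)
  then show ?thesis
    by (simp add: swap_poly_def map_key_compose inj_swap_monom map_key_id)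
qed

lemma swap_poly_0 [simp]: "swap_poly i 0 = 0"
  by (simp add: swap_poly_def inj_swap_monom)

lemma swap_poly_eq_0_iff [simp]: "swap_poly i p = 0 \<longleftrightarrow> p = 0"
  by (metis swap_poly_0 swap_poly_swap_poly)

lemma swap_poly_add: "swap_poly i (p + q) = swap_poly i p + swap_poly i q"
  by (simp add: swap_poly_def map_key_plus inj_swap_monom)

lemma swap_poly_single:
  "swap_poly i (Poly_Mapping.single m c) = Poly_Mapping.single (swap_monom i m) c"
  using map_key_single[OF inj_swap_monom, of i "swap_monom i m" c] by (simp add: swap_poly_def)

lemma zpoly_induct [case_names single add]:
  fixes p :: zpoly
  assumes single: "\<And>m c. P (Poly_Mapping.single m c)"
    and add: "\<And>p q. P p \<Longrightarrow> P q \<Longrightarrow> P (p + q)"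
  shows "P p"
proof (induction p rule: update_induct)
  case const
  show ?case using single[of 0 0] by simp
next
  case (update f a b)
  have "Poly_Mapping.update a b f = f + Poly_Mapping.single a b"
    using update(1)
    by (intro poly_mapping_eqI) (auto simp: lookup_update lookup_add lookup_single in_keys_iff)
  then show ?case using add[OF update(3) single] by simp
qed

lemma swap_poly_mult: "swap_poly i (p * q) = swap_poly i p * swap_poly i q"
proof (induction p rule: zpoly_induct)
  case (single m c)
  show ?case
    by (induction q rule: zpoly_induct)
       (simp_all add: mult_single swap_poly_single swap_monom_add swap_poly_add ring_distribs)
next
  case (add p q)
  then show ?case by (simp add: swap_poly_add ring_distribs)
qed

text \<open>The action of \<open>s\<^sub>i\<close>: apply \<open>swap_poly i\<close> to numerator and denominator.\<close>

lift_definition swap_vars :: "nat \<Rightarrow> ratfun \<Rightarrow> ratfun"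
  is "\<lambda>i pq. (swap_poly i (fst pq), swap_poly i (snd pq))"
  by (auto simp flip: swap_poly_mult)

lemma swap_vars_Fract:
  "q \<noteq> 0 \<Longrightarrow> swap_vars i (Fract p q) = Fract (swap_poly i p) (swap_poly i q)"
  by transfer simp


section \<open>The divided difference operators\<close>

definition D1 :: "nat \<Rightarrow> ratfun \<Rightarrow> ratfun" where
  "D1 i f = inverse (z_ind i - z_ind (i + 1)) * (z_ind i * f - z_ind i * swap_vars i f)"

definition D2 :: "nat \<Rightarrow> ratfun \<Rightarrow> ratfun" where
  "D2 i f = inverse (z_ind i - z_ind (i + 1)) * (z_ind i * f - z_ind (i + 1) * swap_vars i f)"

definition D3 :: "nat \<Rightarrow> ratfun \<Rightarrow> ratfun" where
  "D3 i f = inverse (z_ind i - z_ind (i + 1)) * (z_ind (i + 1) * f - z_ind i * swap_vars i f)"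

definition D4 :: "nat \<Rightarrow> ratfun \<Rightarrow> ratfun" where
  "D4 i f = inverse (z_ind i - z_ind (i + 1)) * (z_ind (i + 1) * f - z_ind (i + 1) * swap_vars i f)"

end

theory Submission
  imports Defs
begin

text \<open>
  The rows \<open>i\<close> and \<open>i + 1\<close> are exchanged by a train argument. The unfused vertices satisfy a
  Yang-Baxter equation whose R-matrix depends on the label \<open>(c, d)\<close> of the vertex and returns to
  its initial value after the \<open>r\<^sup>2\<close> vertices of a fused vertex. Attached to the left boundary, it sees
  two dolors and produces \<open>Z(w1, w2; z)\<close> and \<open>Z(w1, s w2; z)\<close>; moved to the right boundary, it sees
  two colors and produces \<open>Z(w1, w2; s z)\<close> and \<open>Z(s w1, w2; s z)\<close>. The resulting four-term relation
  is the asserted formula, where the Bruhat comparisons of \<open>w1\<close>, \<open>w2\<close> with \<open>s w1\<close>, \<open>s w2\<close> decide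
  which R-matrix entries occur.
\<close>

section \<open>The Yang-Baxter equation\<close>

text \<open>The R-matrix is periodic because a fused vertex lists every color once for each dolor:
  the rotated order of the colors makes \<open>r\<close> full turns, that of the dolors one. Entries
  with one color and one dolor never meet the outer boundary, but the intermediate edges need them.
  One obstacle is finiteness: a vertical edge may carry any number of bosons, and a sum over an
  infinite set is 0 by convention, so labels are truncated by a bound that grows from row to row.
  Another is that the admissible labellings of a fused vertex depend on its vertical edges; giving
  the others weight 0 frees the ranges of summation, so that a column becomes a matrix and a system
  a product of matrices. This is used twice, for the unfused vertices in a column and for the
  columns in the system. The exchange relation holds over every commutative ring; division takes
  place only at the end, in \<open>ratfun\<close>, where \<open>Z(s z)\<close> is the image of
  \<open>Z(z)\<close> under a ring homomorphism.\<close>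

text \<open>
  The top edge \<open>n\<close> and the horizontal edges determine the bottom edge. The truncated
  \<open>n - 1\<close> is harmless, since the corresponding weight vanishes for \<open>n = 0\<close>.
\<close>

fun boson_out :: "spin \<Rightarrow> nat \<Rightarrow> spin \<Rightarrow> nat" where
  "boson_out (Color a) n (Dolor x) = Suc n"
| "boson_out (Dolor x) n (Color a) = n - 1"
| "boson_out (Color a) n (Color b) = n"
| "boson_out (Dolor x) n (Dolor y) = n"

fun vertex_weight :: "'a::comm_ring_1 \<Rightarrow> 'a \<Rightarrow> nat \<times> nat \<Rightarrow> spin \<Rightarrow> nat \<Rightarrow> spin \<Rightarrow> 'a" where
  "vertex_weight t z (c, d) (Dolor x) n (Dolor y) =
     (if x = y then if x = d then 1 else (if c = 1 then z else 1) * (if x < d then t ^ n else 1) else 0)"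
| "vertex_weight t z (c, d) (Color a) n (Color b) =
     (if a = b then if a = c then z else if c > a then t ^ n else 1 else 0)"
| "vertex_weight t z (c, d) (Dolor x) n (Color a) = (if x = d \<and> a = c then \<Sum>k<n. t ^ k else 0)"
| "vertex_weight t z (c, d) (Color a) n (Dolor x) = (if x = d \<and> a = c then (1 - t) * z else 0)"

text \<open>The linear order \<open>Color r\<close>, ..., \<open>Color 1\<close>,
  \<open>Dolor 1\<close>, ..., \<open>Dolor r\<close>. It decides which exchanges carry the factor
  \<open>t\<close> and, unlike the orders behind \<open>R_keep\<close>, never rotates.\<close>

fun spin_less :: "spin \<Rightarrow> spin \<Rightarrow> bool" where
  "spin_less (Color a) (Color b) \<longleftrightarrow> b < a"
| "spin_less (Color a) (Dolor x) \<longleftrightarrow> True"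
| "spin_less (Dolor x) (Color a) \<longleftrightarrow> False"
| "spin_less (Dolor x) (Dolor y) \<longleftrightarrow> x < y"

text \<open>
  The R-matrix in front of an unfused vertex of label \<open>(c, d)\<close>, multiplied by \<open>z1 * z2\<close> to clear
  denominators: \<open>R_keep\<close> is the coefficient that leaves the two spins in their rows and \<open>R_swap\<close> the
  one that exchanges them. Passing straight through a vertex multiplies two spins by different powers
  of \<open>z\<close>, so only \<open>R_keep\<close> depends on the position. For two colors its numerator is governed by the
  cyclically rotated order \<open>c, c + 1, \<dots>, r, 1, \<dots>, c - 1\<close>, and similarly for two dolors. The label
  \<open>(r + 1, d + 1)\<close> stands for \<open>(1, d)\<close>, and \<open>(1, 0)\<close> is the position to the right of all vertices.
\<close>

definition R_swap :: "'a::comm_ring_1 \<Rightarrow> 'a \<Rightarrow> 'a \<Rightarrow> spin \<Rightarrow> spin \<Rightarrow> 'a" where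
  "R_swap t z1 z2 x y =
     (if x = y then 0 else z1 * z2 * (z1 - z2) * (if spin_less x y then t else 1))"

fun R_keep :: "'a::comm_ring_1 \<Rightarrow> 'a \<Rightarrow> 'a \<Rightarrow> nat \<Rightarrow> nat \<Rightarrow> spin \<Rightarrow> spin \<Rightarrow> 'a" where
  "R_keep t z1 z2 c d (Color a) (Color b) = z1 * z2 *
     (if a = b then z1 - t * z2
      else (1 - t) * (if (a < b) = (a < c \<and> \<not> b < c \<or> b < c \<and> \<not> a < c) then z1 else z2))"
| "R_keep t z1 z2 c d (Dolor x) (Dolor y) = z1 * z2 *
     (if x = y then z1 - t * z2
      else (1 - t) * (if (x < y) = (((x > d \<or> x = d \<and> c > 1) \<noteq> (y > d \<or> y = d \<and> c > 1))) then z1 else z2))"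
| "R_keep t z1 z2 c d (Color a) (Dolor x) =
     (1 - t) * z2 * z2 * (if x \<noteq> d \<and> c > 1 \<and> a \<ge> c then z2 else z1)"
| "R_keep t z1 z2 c d (Dolor x) (Color a) =
     (1 - t) * z1 * z1 * (if x \<noteq> d \<and> c > 1 \<and> a \<ge> c then z1 else z2)"

text \<open>Some weights are powers of \<open>t\<close> and others are \<open>t\<close>-numbers;
  this puts both in terms of the latter.\<close>

lemma power_eq_q_number: "(t::'a::comm_ring_1) ^ n = 1 - (1 - t) * (\<Sum>k<n. t ^ k)"
  using one_diff_power_eq[of t n] by (simp add: algebra_simps)

text \<open>
  Two vertices of equal label on top of each other; \<open>F\<close> is an arbitrary function of the number of
  bosons leaving at the bottom.
\<close>

definition two_row_weight where
  "two_row_weight t z1 z2 p F n x y X Y =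
     vertex_weight t z1 p x n X * vertex_weight t z2 p y (boson_out x n X) Y *
     F (boson_out y (boson_out x n X) Y)"

text \<open>Two colors leave the boson number alone, so \<open>F n\<close> is a common factor and
  the outgoing pair must rearrange the incoming one. Passing the vertex moves \<open>c\<close> from
  first to last place in the rotated order, hence \<open>Suc c\<close> on the right.\<close>

lemma yang_baxter_colors:
  fixes t z1 z2 :: "'a::comm_ring_1" and F :: "nat \<Rightarrow> 'a"
  assumes "c \<ge> 1"
  shows "R_keep t z1 z2 c d (Color a) (Color b) * two_row_weight t z1 z2 (c, d) F n (Color a) (Color b) (Color a') (Color b')
       + R_swap t z1 z2 (Color a) (Color b) * two_row_weight t z1 z2 (c, d) F n (Color b) (Color a) (Color a') (Color b')
       = R_keep t z1 z2 (Suc c) d (Color a') (Color b') * two_row_weight t z2 z1 (c, d) F n (Color a) (Color b) (Color a') (Color b')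
       + R_swap t z1 z2 (Color b') (Color a') * two_row_weight t z2 z1 (c, d) F n (Color a) (Color b) (Color b') (Color a')"
proof -
  consider "a' = a" "b' = b" "a \<noteq> b" | "a' = b" "b' = a" "a \<noteq> b" | "a = b" "a' = a" "b' = a"
    | "(a', b') \<noteq> (a, b)" "(a', b') \<noteq> (b, a)" by auto
  then show ?thesis
  proof cases
    case 1
    then show ?thesis using assms
      by (cases a b rule: linorder_cases; cases a c rule: linorder_cases;
          cases b c rule: linorder_cases)
         (simp_all add: two_row_weight_def R_swap_def less_Suc_eq, (simp add: algebra_simps)?)
  next
    case 2
    then show ?thesis using assms
      by (cases a b rule: linorder_cases; cases a c rule: linorder_cases;
          cases b c rule: linorder_cases)
         (simp_all add: two_row_weight_def R_swap_def less_Suc_eq, (simp add: algebra_simps)?)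
  next
    case 3
    then show ?thesis using assms
      by (cases a c rule: linorder_cases)
         (simp_all add: two_row_weight_def R_swap_def less_Suc_eq)
  next
    case 4
    then show ?thesis by (auto simp: two_row_weight_def R_swap_def)
  qed
qed

text \<open>Only vertices with \<open>c = 1\<close> multiply a dolor by \<open>z\<close>, and they
  spare the dolor \<open>d\<close>. So the order of the dolors rotates only there, where
  \<open>d\<close> joins the dolors already passed.\<close>

lemma yang_baxter_dolors:
  fixes t z1 z2 :: "'a::comm_ring_1" and F :: "nat \<Rightarrow> 'a"
  assumes "c \<ge> 1"
  shows "R_keep t z1 z2 c d (Dolor a) (Dolor b) * two_row_weight t z1 z2 (c, d) F n (Dolor a) (Dolor b) (Dolor a') (Dolor b')
       + R_swap t z1 z2 (Dolor a) (Dolor b) * two_row_weight t z1 z2 (c, d) F n (Dolor b) (Dolor a) (Dolor a') (Dolor b')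
       = R_keep t z1 z2 (Suc c) d (Dolor a') (Dolor b') * two_row_weight t z2 z1 (c, d) F n (Dolor a) (Dolor b) (Dolor a') (Dolor b')
       + R_swap t z1 z2 (Dolor b') (Dolor a') * two_row_weight t z2 z1 (c, d) F n (Dolor a) (Dolor b) (Dolor b') (Dolor a')"
proof -
  consider "a' = a" "b' = b" "a \<noteq> b" | "a' = b" "b' = a" "a \<noteq> b" | "a = b" "a' = a" "b' = a"
    | "(a', b') \<noteq> (a, b)" "(a', b') \<noteq> (b, a)" by auto
  then show ?thesis
  proof cases
    case 1
    then show ?thesis using assms
      by (cases "c = 1"; cases a b rule: linorder_cases; cases a d rule: linorder_cases;
          cases b d rule: linorder_cases)
         (simp_all add: two_row_weight_def R_swap_def less_Suc_eq, (simp add: algebra_simps)?)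
  next
    case 2
    then show ?thesis using assms
      by (cases "c = 1"; cases a b rule: linorder_cases; cases a d rule: linorder_cases;
          cases b d rule: linorder_cases)
         (simp_all add: two_row_weight_def R_swap_def less_Suc_eq, (simp add: algebra_simps)?)
  next
    case 3
    then show ?thesis using assms
      by (cases "c = 1"; cases a d rule: linorder_cases)
         (simp_all add: two_row_weight_def R_swap_def less_Suc_eq)
  next
    case 4
    then show ?thesis by (auto simp: two_row_weight_def R_swap_def)
  qed
qed

lemma yang_baxter:
  fixes t z1 z2 :: "'a::comm_ring_1" and F :: "nat \<Rightarrow> 'a"
  assumes "c \<ge> 1" "x \<in> spins r" "y \<in> spins r"
  shows "R_keep t z1 z2 c d x y * two_row_weight t z1 z2 (c, d) F n x y X Y
       + R_swap t z1 z2 x y * two_row_weight t z1 z2 (c, d) F n y x X Y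
       = R_keep t z1 z2 (Suc c) d X Y * two_row_weight t z2 z1 (c, d) F n x y X Y
       + R_swap t z1 z2 Y X * two_row_weight t z2 z1 (c, d) F n x y Y X"
proof -
  define q where "q m = (\<Sum>k<m. t ^ k)" for m
  have t: "t ^ m = 1 - (1 - t) * q m" for m
    unfolding q_def by (rule power_eq_q_number)
  \<comment> \<open>The recursion avoids \<open>t ^ m\<close>, so that the mixed cases become
    polynomial identities in \<open>t\<close>, \<open>z1\<close>, \<open>z2\<close> and
    \<open>q n\<close>.\<close>
  have q: "q 0 = 0" "q (Suc m) = q m + (1 - (1 - t) * q m)" for m
    by (simp_all add: q_def flip: power_eq_q_number)
  note mixed = two_row_weight_def R_swap_def spins_def not_less not_le q_def[symmetric] q
  show ?thesis
  proof (cases x; cases y; cases X; cases Y)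
    fix a b a' b'
    assume "x = Color a" "y = Color b" "X = Color a'" "Y = Color b'"
    then show ?thesis using yang_baxter_colors assms by blast
  next
    fix a b a' b'
    assume "x = Dolor a" "y = Dolor b" "X = Dolor a'" "Y = Dolor b'"
    then show ?thesis using yang_baxter_dolors assms by blast
  qed (use assms in \<open>(cases n; auto simp: mixed; simp add: q t algebra_simps)\<close>)+
qed

section \<open>Path sums and grids\<close>

text \<open>An entry of the matrix product \<open>C 0 * ... * C (n - 1)\<close>, with rows and
  columns indexed by \<open>U\<close>.\<close>

fun path_sum :: "'x set \<Rightarrow> (nat \<Rightarrow> 'x \<Rightarrow> 'x \<Rightarrow> 'a::comm_ring_1) \<Rightarrow> nat \<Rightarrow> 'x \<Rightarrow> 'x \<Rightarrow> 'a" where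
  "path_sum U C 0 x y = (if x = y then 1 else 0)"
| "path_sum U C (Suc n) x y = (\<Sum>u\<in>U. path_sum U C n x u * C n u y)"

definition paths :: "'x set \<Rightarrow> nat \<Rightarrow> 'x \<Rightarrow> 'x \<Rightarrow> (nat \<Rightarrow> 'x) set" where
  "paths U n x y = {e \<in> {0..n} \<rightarrow>\<^sub>E U. e 0 = x \<and> e n = y}"

lemma finite_paths: "finite U \<Longrightarrow> finite (paths U n x y)"
  unfolding paths_def by (simp add: finite_PiE)

lemma sum_paths_eq_path_sum:
  assumes "finite U" "x \<in> U" "y \<in> U"
  shows "(\<Sum>e\<in>paths U n x y. \<Prod>k<n. C k (e k) (e (Suc k))) = path_sum U C n x y"
  using \<open>y \<in> U\<close>
proof (induction n arbitrary: y)
  case 0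
  have "paths U 0 x y = (if x = y then {\<lambda>k\<in>{0}. x} else {})"
    using assms(2) by (auto simp: paths_def PiE_iff extensional_def fun_eq_iff)
  then show ?case by simp
next
  case (Suc n)
  have "(\<Sum>e\<in>paths U (Suc n) x y. \<Prod>k<Suc n. C k (e k) (e (Suc k)))
      = (\<Sum>(u, e)\<in>(SIGMA u:U. paths U n x u). (\<Prod>k<n. C k (e k) (e (Suc k))) * C n u y)"
  proof (rule sum.reindex_bij_witness[where i = "\<lambda>(u, e). e(Suc n := y)"
          and j = "\<lambda>e. (e n, e(Suc n := undefined))"])
    fix e assume e: "e \<in> paths U (Suc n) x y"
    then show "(case (e n, e(Suc n := undefined)) of (u, e) \<Rightarrow> e(Suc n := y)) = e"
      by (auto simp: paths_def)
    show "(e n, e(Suc n := undefined)) \<in> (SIGMA u:U. paths U n x u)"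
      using e by (auto simp: paths_def PiE_iff extensional_def)
    show "(case (e n, e(Suc n := undefined)) of
            (u, e) \<Rightarrow> (\<Prod>k<n. C k (e k) (e (Suc k))) * C n u y) =
          (\<Prod>k<Suc n. C k (e k) (e (Suc k)))"
      using e by (auto simp: paths_def intro!: prod.cong)
  next
    fix a assume a: "a \<in> (SIGMA u:U. paths U n x u)"
    then show "(case a of (u, e) \<Rightarrow> e(Suc n := y)) \<in> paths U (Suc n) x y"
      using Suc.prems by (auto simp: paths_def PiE_iff extensional_def)
    show "((case a of (u, e) \<Rightarrow> e(Suc n := y)) n,
           (case a of (u, e) \<Rightarrow> e(Suc n := y))(Suc n := undefined)) = a"
      using a by (auto simp: paths_def PiE_iff extensional_def fun_eq_iff)
  qed
  also have "\<dots> = (\<Sum>u\<in>U. \<Sum>e\<in>paths U n x u. (\<Prod>k<n. C k (e k) (e (Suc k))) * C n u y)"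
    using assms by (simp add: sum.Sigma finite_paths)
  also have "\<dots> = path_sum U C (Suc n) x y"
    by (simp add: Suc.IH flip: sum_distrib_right)
  finally show ?case .
qed

text \<open>
  The train argument: \<open>a\<close>, \<open>b\<close> and \<open>b'\<close> are the entries of an R-matrix that is moved through
  the factors of the path sum one at a time.
\<close>

lemma path_sum_train:
  assumes s: "\<And>x. x \<in> U \<Longrightarrow> s x \<in> U" "\<And>x. x \<in> U \<Longrightarrow> s (s x) = x"
    and b: "\<And>x. x \<in> U \<Longrightarrow> b' (s x) = b x"
    and C: "\<And>k x y. k < n \<Longrightarrow> x \<in> U \<Longrightarrow> y \<in> U \<Longrightarrow>
      a k x * C k x y + b x * C k (s x) y = a (Suc k) y * C' k x y + b' y * C' k x (s y)"
    and "x \<in> U" "y \<in> U"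
  shows "a 0 x * path_sum U C n x y + b x * path_sum U C n (s x) y
       = a n y * path_sum U C' n x y + b' y * path_sum U C' n x (s y)"
  using C \<open>y \<in> U\<close>
proof (induction n arbitrary: y)
  case 0
  then show ?case using s b \<open>x \<in> U\<close> by (auto, metis)
next
  case (Suc n)
  have "a 0 x * path_sum U C (Suc n) x y + b x * path_sum U C (Suc n) (s x) y
      = (\<Sum>u\<in>U. (a 0 x * path_sum U C n x u + b x * path_sum U C n (s x) u) * C n u y)"
    by (simp add: sum_distrib_left sum.distrib ring_distribs mult.assoc)
  also have "\<dots> = (\<Sum>u\<in>U. (a n u * path_sum U C' n x u + b' u * path_sum U C' n x (s u)) * C n u y)"
    using Suc by (intro sum.cong) auto
  also have "\<dots> = (\<Sum>u\<in>U. path_sum U C' n x u * (a n u * C n u y))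
      + (\<Sum>u\<in>U. path_sum U C' n x (s u) * (b' u * C n u y))"
    by (simp add: sum.distrib ring_distribs mult_ac)
  \<comment> \<open>Substituting \<open>s u\<close> for \<open>u\<close> puts the R-matrix in front
    of the factor \<open>C n\<close>, where the hypothesis \<open>C\<close> applies.\<close>
  also have "(\<Sum>u\<in>U. path_sum U C' n x (s u) * (b' u * C n u y))
      = (\<Sum>u\<in>U. path_sum U C' n x u * (b u * C n (s u) y))"
    by (rule sum.reindex_bij_witness[where i = s and j = s]) (use s b in auto, metis)
  also have "(\<Sum>u\<in>U. path_sum U C' n x u * (a n u * C n u y)) + \<dots>
      = (\<Sum>u\<in>U. path_sum U C' n x u * (a n u * C n u y + b u * C n (s u) y))"
    by (simp add: sum.distrib ring_distribs)
  also have "\<dots> = (\<Sum>u\<in>U. path_sum U C' n x u * (a (Suc n) y * C' n u y + b' y * C' n u (s y)))"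
    using Suc.prems by (intro sum.cong) auto
  also have "\<dots> = a (Suc n) y * path_sum U C' (Suc n) x y + b' y * path_sum U C' (Suc n) x (s y)"
    by (simp add: sum_distrib_left sum.distrib ring_distribs mult_ac)
  finally show ?case .
qed

section \<open>Transfer matrices of columns\<close>

definition column_states :: "nat \<Rightarrow> (nat \<Rightarrow> 'v set) \<Rightarrow> 'v \<Rightarrow> 'v \<Rightarrow> (nat \<Rightarrow> 'v) set" where
  "column_states r V T B = {v \<in> Pi\<^sub>E {0..r} V. v 0 = T \<and> v r = B}"

text \<open>The transfer matrix of a column: its indices \<open>X\<close> and \<open>Y\<close> label
  the horizontal edges on its two sides, and the inner vertical edges are summed out.\<close>

definition column_sum ::
  "nat \<Rightarrow> (nat \<Rightarrow> 'v set) \<Rightarrow> (nat \<Rightarrow> 's \<Rightarrow> 'v \<Rightarrow> 's \<Rightarrow> 'v \<Rightarrow> 'a::comm_ring_1) \<Rightarrow> 'v \<Rightarrow> 'v \<Rightarrow>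
   (nat \<Rightarrow> 's) \<Rightarrow> (nat \<Rightarrow> 's) \<Rightarrow> 'a" where
  "column_sum r V w T B X Y =
     (\<Sum>v\<in>column_states r V T B. \<Prod>i\<in>{1..r}. w i (X i) (v (i - 1)) (Y i) (v i))"

definition row_spins :: "nat \<Rightarrow> 's set \<Rightarrow> (nat \<Rightarrow> 's) set" where
  "row_spins r S = {1..r} \<rightarrow>\<^sub>E S"

definition grid_states where
  "grid_states r N S V X0 X1 T B =
     {(h, v). h \<in> {1..r} \<rightarrow>\<^sub>E ({0..N} \<rightarrow>\<^sub>E S) \<and> v \<in> (\<Pi>\<^sub>E i\<in>{0..r}. {0..<N} \<rightarrow>\<^sub>E V i) \<and>
        (\<forall>i\<in>{1..r}. h i 0 = X0 i \<and> h i N = X1 i) \<and> (\<forall>j<N. v 0 j = T j \<and> v r j = B j)}"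

text \<open>Once the horizontal edges are fixed, the columns are independent and the sum over the
  vertical edges factors; the horizontal edges themselves form a path through the row
  labellings.\<close>

lemma grid_sum_eq_path_sum:
  fixes w :: "nat \<Rightarrow> nat \<Rightarrow> 's \<Rightarrow> 'v \<Rightarrow> 's \<Rightarrow> 'v \<Rightarrow> 'a::comm_ring_1"
  assumes S: "finite S" and V: "\<And>i. finite (V i)"
    and X0: "X0 \<in> row_spins r S" and X1: "X1 \<in> row_spins r S"
  shows "(\<Sum>(h, v)\<in>grid_states r N S V X0 X1 T B.
            \<Prod>i\<in>{1..r}. \<Prod>j<N. w i j (h i j) (v (i - 1) j) (h i (Suc j)) (v i j))
       = path_sum (row_spins r S) (\<lambda>j. column_sum r V (\<lambda>i. w i j) (T j) (B j)) N X0 X1"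
    (is "?lhs = path_sum ?U ?C N X0 X1")
proof -
  have U: "finite ?U" using S by (simp add: row_spins_def finite_PiE)
  have cs: "finite (column_states r V tp bt)" for tp bt
    using V by (simp add: column_states_def finite_PiE)
  let ?H = "paths ?U N X0 X1" and ?V = "Pi\<^sub>E {..<N} (\<lambda>j. column_states r V (T j) (B j))"
  have "?lhs = (\<Sum>(e, u)\<in>?H \<times> ?V.
      \<Prod>j<N. \<Prod>i\<in>{1..r}. w i j (e j i) (u j (i - 1)) (e (Suc j) i) (u j i))"
  proof (rule sum.reindex_bij_witness[where
        i = "\<lambda>(e, u). (\<lambda>i\<in>{1..r}. \<lambda>j\<in>{0..N}. e j i, \<lambda>i\<in>{0..r}. \<lambda>j\<in>{0..<N}. u j i)" and
        j = "\<lambda>(h, v). (\<lambda>j\<in>{0..N}. \<lambda>i\<in>{1..r}. h i j, \<lambda>j\<in>{..<N}. \<lambda>i\<in>{0..r}. v i j)"],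
      goal_cases)
    case (1 a)
    obtain h v where a: "a = (h, v)" by (cases a)
    have "h \<in> {1..r} \<rightarrow>\<^sub>E ({0..N} \<rightarrow>\<^sub>E S)" "v \<in> (\<Pi>\<^sub>E i\<in>{0..r}. {0..<N} \<rightarrow>\<^sub>E V i)"
      using 1 by (auto simp: a grid_states_def)
    then show ?case
      by (auto simp: a PiE_iff extensional_def fun_eq_iff restrict_def)
  next
    case (2 a)
    obtain h v where a: "a = (h, v)" by (cases a)
    show ?case
      using 2 X0 X1
      by (auto simp: a grid_states_def paths_def row_spins_def column_states_def PiE_iff
          extensional_def fun_eq_iff restrict_def)
  next
    case (3 a)
    obtain e u where a: "a = (e, u)" by (cases a)
    have e: "e \<in> {0..N} \<rightarrow>\<^sub>E ({1..r} \<rightarrow>\<^sub>E S)" "u \<in> (\<Pi>\<^sub>E j\<in>{..<N}. Pi\<^sub>E {0..r} V)"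
      using 3 by (auto simp: a paths_def row_spins_def column_states_def PiE_iff)
    then show ?case
      by (auto simp: a PiE_iff extensional_def fun_eq_iff restrict_def)
  next
    case (4 a)
    obtain e u where a: "a = (e, u)" by (cases a)
    show ?case
      using 4
      by (auto simp: a grid_states_def paths_def row_spins_def column_states_def PiE_iff
          extensional_def fun_eq_iff restrict_def)
  next
    case (5 a)
    obtain h v where a: "a = (h, v)" by (cases a)
    show ?case
      unfolding a prod.case by (subst prod.swap) (auto intro!: prod.cong)
  qed
  also have "\<dots> = (\<Sum>e\<in>?H. \<Sum>u\<in>?V.
      \<Prod>j<N. \<Prod>i\<in>{1..r}. w i j (e j i) (u j (i - 1)) (e (Suc j) i) (u j i))"
    by (simp add: sum.cartesian_product)
  also have "\<dots> = (\<Sum>e\<in>?H. \<Prod>j<N. ?C j (e j) (e (Suc j)))"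
    unfolding column_sum_def by (subst prod_sum_PiE) (auto simp: cs)
  also have "\<dots> = path_sum ?U ?C N X0 X1"
    using U X0 X1 by (rule sum_paths_eq_path_sum)
  finally show ?thesis .
qed

text \<open>Isolates the one vertical edge that lies between the rows to be exchanged.\<close>

lemma column_sum_split:
  assumes i: "1 \<le> i" "i < r" and V: "\<And>i. finite (V i)"
  shows "column_sum r V w T B X Y =
    (\<Sum>u | u \<in> Pi\<^sub>E ({0..r} - {i}) V \<and> u 0 = T \<and> u r = B.
       (\<Prod>j\<in>{1..r} - {i, Suc i}. w j (X j) (u (j - 1)) (Y j) (u j)) *
       (\<Sum>m\<in>V i. w i (X i) (u (i - 1)) (Y i) m * w (Suc i) (X (Suc i)) m (Y (Suc i)) (u (Suc i))))"
    (is "_ = sum ?f ?P")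
proof -
  have fin: "finite ?P"
    by (rule finite_subset[of _ "Pi\<^sub>E ({0..r} - {i}) V"]) (use V in \<open>auto intro!: finite_PiE\<close>)
  let ?rest = "\<lambda>u. \<Prod>j\<in>{1..r} - {i, Suc i}. w j (X j) (u (j - 1)) (Y j) (u j)"
  have "column_sum r V w T B X Y =
    (\<Sum>(u, m)\<in>?P \<times> V i. ?rest u *
       (w i (X i) (u (i - 1)) (Y i) m * w (Suc i) (X (Suc i)) m (Y (Suc i)) (u (Suc i))))"
    unfolding column_sum_def
  proof (rule sum.reindex_bij_witness[where i = "\<lambda>(u, m). u(i := m)" and
        j = "\<lambda>v. (v(i := undefined), v i)"], goal_cases)
    case (2 v)
    then show ?case using i
      by (auto simp: column_states_def PiE_iff extensional_def)
  next
    case (3 b)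
    then show ?case using i
      by (auto simp: column_states_def PiE_iff extensional_def fun_eq_iff)
  next
    case (4 b)
    then show ?case using i
      by (auto simp: column_states_def PiE_iff extensional_def)
  next
    case (5 v)
    have "{1..r} = insert i (insert (Suc i) ({1..r} - {i, Suc i}))" using i by auto
    then have "(\<Prod>j\<in>{1..r}. w j (X j) (v (j - 1)) (Y j) (v j)) =
      w i (X i) (v (i - 1)) (Y i) (v i) * w (Suc i) (X (Suc i)) (v i) (Y (Suc i)) (v (Suc i)) * ?rest v"
      by (smt (verit) Diff_iff diff_Suc_1 finite_Diff finite_atLeastAtMost finite_insert insertCI mult.assoc n_not_Suc_n prod.insert insertE)
    \<comment> \<open>Row \<open>j\<close> reads \<open>v (j - 1)\<close> and \<open>v j\<close>, so
      the value at \<open>i\<close> enters only through the rows \<open>i\<close> and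
      \<open>Suc i\<close>.\<close>
    moreover have "?rest (v(i := undefined)) = ?rest v"
      by (intro prod.cong) auto
    moreover have "i - Suc 0 \<noteq> i" using i by simp
    ultimately show ?case by (simp add: mult_ac)
  qed simp
  also have "\<dots> = sum ?f ?P"
    by (simp add: sum_distrib_left flip: sum.cartesian_product)
  finally show ?thesis .
qed

text \<open>The other rows contribute the common factor \<open>rest u\<close>, so a relation for two
  vertices on top of each other lifts to the whole column.\<close>

lemma column_sum_exchange:
  fixes w w' :: "nat \<Rightarrow> 's \<Rightarrow> 'v \<Rightarrow> 's \<Rightarrow> 'v \<Rightarrow> 'a::comm_ring_1"
  assumes i: "1 \<le> i" "i < r" and V: "\<And>i. finite (V i)"
    and w': "\<And>j. j \<noteq> i \<Longrightarrow> j \<noteq> Suc i \<Longrightarrow> w' j = w j"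
    and X: "X \<in> row_spins r S" and Y: "Y \<in> row_spins r S"
    and local: "\<And>n n' x y x' y'. n \<in> V (i - 1) \<Longrightarrow> x \<in> S \<Longrightarrow> y \<in> S \<Longrightarrow> x' \<in> S \<Longrightarrow> y' \<in> S \<Longrightarrow>
      a x y * (\<Sum>m\<in>V i. w i x n x' m * w (Suc i) y m y' n') +
      b x y * (\<Sum>m\<in>V i. w i y n x' m * w (Suc i) x m y' n') =
      a' x' y' * (\<Sum>m\<in>V i. w' i x n x' m * w' (Suc i) y m y' n') +
      b y' x' * (\<Sum>m\<in>V i. w' i x n y' m * w' (Suc i) y m x' n')"
  shows "a (X i) (X (Suc i)) * column_sum r V w T B X Y +
         b (X i) (X (Suc i)) * column_sum r V w T B (X \<circ> simple_refl i) Y =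
         a' (Y i) (Y (Suc i)) * column_sum r V w' T B X Y +
         b (Y (Suc i)) (Y i) * column_sum r V w' T B X (Y \<circ> simple_refl i)"
proof -
  let ?P = "{u. u \<in> Pi\<^sub>E ({0..r} - {i}) V \<and> u 0 = T \<and> u r = B}"
  define rest where "rest u = (\<Prod>j\<in>{1..r} - {i, Suc i}. w j (X j) (u (j - 1)) (Y j) (u j))" for u
  define two where "two = (\<lambda>(w :: nat \<Rightarrow> 's \<Rightarrow> 'v \<Rightarrow> 's \<Rightarrow> 'v \<Rightarrow> 'a) u x y x' y'.
    (\<Sum>m\<in>V i. w i x (u (i - 1)) x' m * w (Suc i) y m y' (u (Suc i))))"
  have split: "column_sum r V v T B X' Y' =
      (\<Sum>u\<in>?P. rest u * two v u (X' i) (X' (Suc i)) (Y' i) (Y' (Suc i)))"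
    if "\<And>j. j \<noteq> i \<Longrightarrow> j \<noteq> Suc i \<Longrightarrow> v j = w j \<and> X' j = X j \<and> Y' j = Y j" for v X' Y'
    unfolding column_sum_split[OF i V] rest_def two_def using that
    by (intro sum.cong arg_cong2[where f = "(*)"] prod.cong) auto
  have S: "X i \<in> S" "X (Suc i) \<in> S" "Y i \<in> S" "Y (Suc i) \<in> S"
    using X Y i by (auto simp: row_spins_def)
  have "a (X i) (X (Suc i)) * two w u (X i) (X (Suc i)) (Y i) (Y (Suc i)) +
        b (X i) (X (Suc i)) * two w u (X (Suc i)) (X i) (Y i) (Y (Suc i)) =
        a' (Y i) (Y (Suc i)) * two w' u (X i) (X (Suc i)) (Y i) (Y (Suc i)) +
        b (Y (Suc i)) (Y i) * two w' u (X i) (X (Suc i)) (Y (Suc i)) (Y i)" if "u \<in> ?P" for u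
  proof -
    have "u (i - 1) \<in> V (i - 1)" using that i by (auto simp: PiE_iff)
    then show ?thesis unfolding two_def using S by (rule local)
  qed
  then have "(\<Sum>u\<in>?P. rest u * (a (X i) (X (Suc i)) * two w u (X i) (X (Suc i)) (Y i) (Y (Suc i)) +
        b (X i) (X (Suc i)) * two w u (X (Suc i)) (X i) (Y i) (Y (Suc i)))) =
     (\<Sum>u\<in>?P. rest u * (a' (Y i) (Y (Suc i)) * two w' u (X i) (X (Suc i)) (Y i) (Y (Suc i)) +
        b (Y (Suc i)) (Y i) * two w' u (X i) (X (Suc i)) (Y (Suc i)) (Y i)))"
    by (intro sum.cong) auto
  then show ?thesis
    using w' by (simp add: split sum_distrib_left sum.distrib ring_distribs mult_ac transpose_def)
qed

section \<open>Partition functions as path sums\<close>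

definition unfused_vertex ::
  "'a::comm_ring_1 \<Rightarrow> 'a \<Rightarrow> nat \<times> nat \<Rightarrow> spin \<Rightarrow> nat \<Rightarrow> spin \<Rightarrow> nat \<Rightarrow> 'a" where
  "unfused_vertex t z p x n y m =
     (if unfused_admissible p x n y m then unfused_weight t z p x n y m else 0)"

lemma unfused_vertex_eq:
  "unfused_vertex t z p x n y m = (if m = boson_out x n y then vertex_weight t z p x n y else 0)"
  by (cases p; cases x; cases y; cases n) (auto simp: unfused_vertex_def)

lemma boson_out_le: "boson_out x n y \<le> Suc n"
  by (cases x; cases y) auto

text \<open>From \<open>k\<close> to \<open>k + 1\<close> either the color goes up by one or, after
  color \<open>r\<close>, the next lower dolor starts again at color 1.\<close>

lemma color_dolor_pairs_nth:
  assumes "k < r\<^sup>2"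
  shows "color_dolor_pairs r ! k = (k mod r + 1, r - k div r)"
proof -
  have "concat (map (\<lambda>d. map (\<lambda>c. (c, d)) [1..<r + 1]) ds) ! k = (k mod r + 1, ds ! (k div r))"
    if "k < length ds * r" for ds k
    using that
  proof (induction ds arbitrary: k)
    case (Cons d ds)
    show ?case
    proof (cases "k < r")
      case True
      then show ?thesis by (simp add: nth_append del: upt_Suc)
    next
      case False
      then obtain l where l: "k = r + l" by (metis le_Suc_ex not_less)
      have "r \<noteq> 0" using Cons.prems by (intro notI) simp
      then show ?thesis using Cons.IH[of l] Cons.prems
        by (simp add: nth_append l div_add_self1 del: upt_Suc)
    qed
  qed simp
  from this[of k "rev [1..<r + 1]"] have "color_dolor_pairs r ! k = (k mod r + 1, rev [1..<r + 1] ! (k div r))"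
    using assms by (simp add: color_dolor_pairs_def power2_eq_square del: upt_Suc)
  moreover have "k div r < r"
    using assms by (simp add: power2_eq_square less_mult_imp_div_less)
  then have "rev [1..<r + 1] ! (k div r) = r - k div r"
    by (simp add: rev_nth del: upt_Suc)
  ultimately show ?thesis by simp
qed

lemma bij_betw_color_dolor_pairs:
  "bij_betw (\<lambda>k. color_dolor_pairs r ! k) {..<r\<^sup>2} ({1..r} \<times> {1..r})"
proof -
  have "distinct (color_dolor_pairs r)"
    by (intro card_distinct)
       (simp add: set_color_dolor_pairs length_color_dolor_pairs power2_eq_square)
  then show ?thesis
    using bij_betw_nth[of "color_dolor_pairs r" "{..<r\<^sup>2}" "{1..r} \<times> {1..r}"]
    by (simp add: set_color_dolor_pairs length_color_dolor_pairs)
qed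

lemma finite_spins: "finite (spins r)"
  by (simp add: spins_def)

text \<open>With inadmissible labellings counted at weight 0, the range of summation no longer
  depends on \<open>T\<close> and \<open>B\<close>.\<close>

lemma fused_weight_eq_sum_paths:
  "fused_weight r t z x T y B = (\<Sum>e\<in>paths (spins r) (r\<^sup>2) x y. \<Prod>k<r\<^sup>2.
     let p = color_dolor_pairs r ! k in unfused_vertex t z p (e k) (T p) (e (Suc k)) (B p))"
  unfolding fused_weight_def
proof (rule sum.mono_neutral_cong_left)
  show "finite (paths (spins r) (r\<^sup>2) x y)"
    by (rule finite_paths[OF finite_spins])
  show "internal_labellings r x T y B \<subseteq> paths (spins r) (r\<^sup>2) x y"
    by (auto simp: internal_labellings_def paths_def)
  show "\<forall>e\<in>paths (spins r) (r\<^sup>2) x y - internal_labellings r x T y B. (\<Prod>k<r\<^sup>2.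
     let p = color_dolor_pairs r ! k in unfused_vertex t z p (e k) (T p) (e (Suc k)) (B p)) = 0"
  proof
    fix e assume "e \<in> paths (spins r) (r\<^sup>2) x y - internal_labellings r x T y B"
    then obtain k where "k < r\<^sup>2" "\<not> unfused_admissible (color_dolor_pairs r ! k) (e k)
        (T (color_dolor_pairs r ! k)) (e (Suc k)) (B (color_dolor_pairs r ! k))"
      by (auto simp: internal_labellings_def paths_def Let_def)
    then show "(\<Prod>k<r\<^sup>2. let p = color_dolor_pairs r ! k in
        unfused_vertex t z p (e k) (T p) (e (Suc k)) (B p)) = 0"
      unfolding Let_def by (intro prod_zero bexI[of _ k]) (auto simp: unfused_vertex_def)
  qed
qed (auto simp: internal_labellings_def unfused_vertex_def Let_def intro!: prod.cong)

text \<open>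
  The bound grows with the row because every vertex adds at most one boson of each type. Thus no
  configuration of the vertex below a label in \<open>bounded_labels r i\<close> is cut off by
  \<open>bounded_labels r (i + 1)\<close>.
\<close>

definition bounded_labels :: "nat \<Rightarrow> nat \<Rightarrow> (nat \<times> nat \<Rightarrow> nat) set" where
  "bounded_labels r i = {m \<in> boson_labels r. \<forall>p. m p \<le> r + i}"

lemma finite_bounded_labels: "finite (bounded_labels r i)"
proof -
  have "bounded_labels r i =
    {m. \<forall>p. (p \<in> {1..r} \<times> {1..r} \<longrightarrow> m p \<in> {..r + i}) \<and> (p \<notin> {1..r} \<times> {1..r} \<longrightarrow> m p = 0)}"
    unfolding bounded_labels_def boson_labels_def by (auto; metis atMost_iff bot_nat_0.extremum)
  then show ?thesis
    using finite_set_of_finite_funs[of "{1..r} \<times> {1..r}" "{..r + i}" 0] by simp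
qed

text \<open>A fused column is a grid of \<open>r\<close> rows and \<open>r\<^sup>2\<close> unfused
  columns; a multiplicity function on a vertical edge is regrouped into one number for each unfused
  column.\<close>

lemma fused_column_eq_path_sum:
  assumes X: "X \<in> row_spins r (spins r)" and Y: "Y \<in> row_spins r (spins r)"
    and T: "T \<in> boson_labels r" and B: "B \<in> boson_labels r"
  shows "column_sum r (bounded_labels r) (\<lambda>i. fused_weight r t (z i)) T B X Y =
    path_sum (row_spins r (spins r))
      (\<lambda>k. let p = color_dolor_pairs r ! k in
         column_sum r (\<lambda>i. {0..r + i}) (\<lambda>i. unfused_vertex t (z i) p) (T p) (B p)) (r\<^sup>2) X Y"
proof -
  let ?p = "\<lambda>k. color_dolor_pairs r ! k" and ?Q = "{1..r} \<times> {1..r}"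
  let ?W = "\<lambda>i k. unfused_vertex t (z i) (?p k)"
  let ?H = "\<Pi>\<^sub>E i\<in>{1..r}. paths (spins r) (r\<^sup>2) (X i) (Y i)"
  let ?CS = "column_states r (bounded_labels r) T B"
  let ?G = "grid_states r (r\<^sup>2) (spins r) (\<lambda>i. {0..r + i}) X Y (\<lambda>k. T (?p k)) (\<lambda>k. B (?p k))"
  define idx where "idx = the_inv_into {..<r\<^sup>2} ?p"
  have idx: "idx (?p k) = k" if "k < r\<^sup>2" for k
    unfolding idx_def using bij_betw_color_dolor_pairs that
    by (intro the_inv_into_f_f) (auto simp: bij_betw_def)
  have idx': "idx q < r\<^sup>2" "?p (idx q) = q" if "q \<in> ?Q" for q
  proof -
    have "q \<in> ?p ` {..<r\<^sup>2}"
      using bij_betw_color_dolor_pairs[of r] that by (simp add: bij_betw_def)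
    then show "idx q < r\<^sup>2" "?p (idx q) = q" using idx by auto
  qed
  have p: "?p k \<in> ?Q" if "k < r\<^sup>2" for k
    using bij_betwE[OF bij_betw_color_dolor_pairs[of r]] that by blast
  have "column_sum r (bounded_labels r) (\<lambda>i. fused_weight r t (z i)) T B X Y =
    (\<Sum>v\<in>?CS. \<Sum>h\<in>?H. \<Prod>i\<in>{1..r}. \<Prod>k<r\<^sup>2.
       ?W i k (h i k) (v (i - 1) (?p k)) (h i (Suc k)) (v i (?p k)))"
    unfolding column_sum_def fused_weight_eq_sum_paths Let_def
    by (subst prod_sum_PiE) (auto intro: finite_paths finite_spins)
  also have "\<dots> = (\<Sum>(v, h)\<in>?CS \<times> ?H. \<Prod>i\<in>{1..r}. \<Prod>k<r\<^sup>2.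
       ?W i k (h i k) (v (i - 1) (?p k)) (h i (Suc k)) (v i (?p k)))"
    by (simp add: sum.cartesian_product)
  also have "\<dots> = (\<Sum>(h, v)\<in>?G. \<Prod>i\<in>{1..r}. \<Prod>k<r\<^sup>2.
       ?W i k (h i k) (v (i - 1) k) (h i (Suc k)) (v i k))"
  \<comment> \<open>The value 0 outside \<open>?Q\<close> is the one that
    \<open>boson_labels\<close> prescribes.\<close>
  proof (rule sum.reindex_bij_witness[where
        j = "\<lambda>(v, h). (h, \<lambda>i\<in>{0..r}. \<lambda>k\<in>{0..<r\<^sup>2}. v i (?p k))" and
        i = "\<lambda>(h, v). (\<lambda>i\<in>{0..r}. \<lambda>q. if q \<in> ?Q then v i (idx q) else 0, h)"],
      goal_cases)
    case (1 a)
    obtain v h where a: "a = (v, h)" by (cases a)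
    have "v i q = 0" if "i \<le> r" "q \<notin> ?Q" for i q
    proof -
      have "v i \<in> boson_labels r"
        using 1 that(1) by (auto simp: a column_states_def bounded_labels_def PiE_iff)
      then show ?thesis using that(2) unfolding boson_labels_def by blast
    qed
    moreover have "v \<in> extensional {0..r}"
      using 1 by (auto simp: a column_states_def PiE_iff)
    ultimately show ?case
      using idx' by (auto simp: a fun_eq_iff restrict_def extensional_def)
  next
    case (2 a)
    obtain v h where a: "a = (v, h)" by (cases a)
    have le: "v i q \<le> r + i" if "i \<le> r" for i q
      using 2 that by (auto simp: a column_states_def bounded_labels_def PiE_iff simp del: split_paired_All)
    show ?case
      using 2 le by (auto simp: a grid_states_def column_states_def paths_def PiE_iff)
  next
    case (3 a)
    obtain h v where a: "a = (h, v)" by (cases a)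
    have "v i \<in> extensional {0..<r\<^sup>2}" if "i \<le> r" for i
      using 3 that by (auto simp: a grid_states_def PiE_iff)
    moreover have "v \<in> extensional {0..r}"
      using 3 by (auto simp: a grid_states_def PiE_iff)
    ultimately show ?case
      using idx p by (auto simp: a fun_eq_iff restrict_def extensional_def)
  next
    case (4 a)
    obtain h v where a: "a = (h, v)" by (cases a)
    have "(\<lambda>q. if q \<in> ?Q then v 0 (idx q) else 0) = T"
      using 4 T idx' by (auto simp: a grid_states_def boson_labels_def fun_eq_iff)
    moreover have "(\<lambda>q. if q \<in> ?Q then v r (idx q) else 0) = B"
      using 4 B idx' by (auto simp: a grid_states_def boson_labels_def fun_eq_iff)
    moreover have "(\<lambda>q. if q \<in> ?Q then v i (idx q) else 0) \<in> bounded_labels r i" if "i \<le> r" for i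
      using 4 idx' that
      by (auto simp: a grid_states_def bounded_labels_def boson_labels_def PiE_iff)
    moreover have "h \<in> ?H"
      using 4 by (auto simp: a grid_states_def paths_def PiE_iff)
    ultimately show ?case
      by (auto simp: a column_states_def)
  next
    case (5 a)
    obtain v h where a: "a = (v, h)" by (cases a)
    show ?case
      by (auto simp: a intro!: prod.cong)
  qed
  also have "\<dots> = path_sum (row_spins r (spins r))
      (\<lambda>k. column_sum r (\<lambda>i. {0..r + i}) (\<lambda>i. ?W i k) (T (?p k)) (B (?p k))) (r\<^sup>2) X Y"
    by (rule grid_sum_eq_path_sum) (use X Y finite_spins in auto)
  finally show ?thesis by (simp add: Let_def)
qed

lemma unfused_admissible_le: "unfused_admissible p x n y m \<Longrightarrow> m \<le> Suc n"
  by (cases p; cases x; cases y) auto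

lemma fused_admissible_le:
  assumes "fused_admissible r x T y B" "p \<in> {1..r} \<times> {1..r}"
  shows "B p \<le> Suc (T p)"
proof -
  obtain e where e: "e \<in> internal_labellings r x T y B"
    using assms by (auto simp: fused_admissible_def)
  have "p \<in> (\<lambda>k. color_dolor_pairs r ! k) ` {..<r\<^sup>2}"
    using assms(2) bij_betw_imp_surj_on[OF bij_betw_color_dolor_pairs[of r]] by metis
  then obtain k where "k < r\<^sup>2" "color_dolor_pairs r ! k = p" by auto
  then have "unfused_admissible p (e k) (T p) (e (Suc k)) (B p)"
    using e by (auto simp: internal_labellings_def Let_def)
  then show ?thesis by (rule unfused_admissible_le)
qed

text \<open>The top boundary holds \<open>r\<close> bosons in all, which gives the bound
  \<open>r + i\<close> its starting value.\<close>

lemma top_boundary_bounded_labels: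
  assumes w: "w3 permutes {1..r}" "w4 permutes {1..r}"
  shows "top_boundary r lam w3 w4 j \<in> bounded_labels r 0"
proof -
  have "inv w3 k \<in> {1..r}" "inv w4 (long_elt r k) \<in> {1..r}" if "k \<in> {1..r}" for k
    using that permutes_in_image[OF permutes_inv[OF w(1)]]
      permutes_in_image[OF permutes_inv[OF w(2)], of "long_elt r k"]
    by (simp_all add: long_elt_def, presburger)
  then have "{k \<in> {1..r}. lam k = j \<and> p = (inv w3 k, inv w4 (long_elt r k))} = {}"
    if "p \<notin> {1..r} \<times> {1..r}" for p using that by blast
  moreover have "card {k \<in> {1..r}. lam k = j \<and> p = (inv w3 k, inv w4 (long_elt r k))} \<le> r" for p
  proof -
    have "{k \<in> {1..r}. lam k = j \<and> p = (inv w3 k, inv w4 (long_elt r k))} \<subseteq> {1..r}"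
      by blast
    from card_mono[OF _ this] show ?thesis by simp
  qed
  ultimately show ?thesis
    by (auto simp: bounded_labels_def boson_labels_def top_boundary_def simp del: mem_Sigma_iff)
qed

definition boundary :: "nat \<Rightarrow> (nat \<Rightarrow> spin) \<Rightarrow> (nat \<Rightarrow> nat) \<Rightarrow> nat \<Rightarrow> spin" where
  "boundary r f w = (\<lambda>i\<in>{1..r}. f (inv w i))"

definition fused_column where
  "fused_column r t z T = column_sum r (bounded_labels r) (\<lambda>i. fused_weight r t (z i)) T (\<lambda>_. 0)"

text \<open>
  Columns are numbered from right to left, so the path starts at the right boundary.
\<close>

lemma partition_function_eq_path_sum:
  assumes w: "w1 permutes {1..r}" "w2 permutes {1..r}" "w3 permutes {1..r}" "w4 permutes {1..r}"
  shows "partition_function r N lam w1 w2 w3 w4 t z =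
    path_sum (row_spins r (spins r))
      (\<lambda>j X Y. fused_column r t z (top_boundary r lam w3 w4 j) Y X) N
      (boundary r Color w1) (boundary r Dolor w2)"
proof -
  let ?T = "top_boundary r lam w3 w4"
  let ?G = "grid_states r N (spins r) (bounded_labels r) (boundary r Color w1) (boundary r Dolor w2)
    ?T (\<lambda>_ _. 0)"
  let ?w = "\<lambda>i (j::nat) x n y m. fused_weight r t (z i) y n x m"
  have inv: "inv w i \<in> {1..r}" if "w permutes {1..r}" "i \<in> {1..r}" for w i
    using that by (metis permutes_in_image permutes_inv)
  have bd: "boundary r Color w1 \<in> row_spins r (spins r)" "boundary r Dolor w2 \<in> row_spins r (spins r)"
    using inv w by (auto simp: boundary_def row_spins_def spins_def)
  have fin: "finite ?G"
  proof (rule finite_subset)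
    show "?G \<subseteq> ({1..r} \<rightarrow>\<^sub>E ({0..N} \<rightarrow>\<^sub>E spins r)) \<times>
        (\<Pi>\<^sub>E i\<in>{0..r}. {0..<N} \<rightarrow>\<^sub>E bounded_labels r i)"
      by (auto simp: grid_states_def)
  qed (auto intro!: finite_PiE finite_spins finite_bounded_labels)
  \<comment> \<open>Every state obeys the truncation, by descending from the top boundary one row at
    a time.\<close>
  have bound: "v i j \<in> bounded_labels r i"
    if "(h, v) \<in> states r N lam w1 w2 w3 w4" "i \<le> r" "j < N" for h v i j
    using that(2)
  proof (induction i)
    case 0
    then show ?case
      using that top_boundary_bounded_labels[OF w(3,4)] by (auto simp: states_def)
  next
    case (Suc i)
    have adm: "fused_admissible r (h (Suc i) (j + 1)) (v i j) (h (Suc i) j) (v (Suc i) j)"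
      using that Suc.prems unfolding states_def by (auto dest!: bspec[where x = "Suc i"])
    have lab: "v (Suc i) j \<in> boson_labels r"
      using that Suc.prems by (auto simp: states_def PiE_iff)
    have "v (Suc i) j p \<le> r + Suc i" for p
    proof (cases "p \<in> {1..r} \<times> {1..r}")
      case True
      have "v i j p \<le> r + i" using Suc.IH Suc.prems by (simp add: bounded_labels_def del: split_paired_All)
      then show ?thesis using fused_admissible_le[OF adm True] by simp
    next
      case False
      then have "v (Suc i) j p = 0" using lab unfolding boson_labels_def by blast
      then show ?thesis by simp
    qed
    then show ?case using lab by (simp add: bounded_labels_def)
  qed
  have "partition_function r N lam w1 w2 w3 w4 t z =
    (\<Sum>(h, v)\<in>?G. \<Prod>i\<in>{1..r}. \<Prod>j<N. ?w i j (h i j) (v (i - 1) j) (h i (Suc j)) (v i j))"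
    unfolding partition_function_def
  proof (rule sum.mono_neutral_cong_left[OF fin])
    show "states r N lam w1 w2 w3 w4 \<subseteq> ?G"
    proof
      fix a assume a: "a \<in> states r N lam w1 w2 w3 w4"
      obtain h v where hv: "a = (h, v)" by (cases a)
      have "v \<in> (\<Pi>\<^sub>E i\<in>{0..r}. {0..<N} \<rightarrow>\<^sub>E bounded_labels r i)"
        using a bound[of h v] by (auto simp: hv states_def PiE_iff)
      then show "a \<in> ?G"
        using a by (auto simp: hv grid_states_def states_def boundary_def)
    qed
    \<comment> \<open>A grid configuration that is not a state has an inadmissible vertex, whose
      weight is an empty sum.\<close>
    show "\<forall>a\<in>?G - states r N lam w1 w2 w3 w4.
      (case a of (h, v) \<Rightarrow> \<Prod>i\<in>{1..r}. \<Prod>j<N. ?w i j (h i j) (v (i - 1) j) (h i (Suc j)) (v i j)) = 0"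
    proof
      fix a assume a: "a \<in> ?G - states r N lam w1 w2 w3 w4"
      obtain h v where hv: "a = (h, v)" by (cases a)
      have "v \<in> {0..r} \<rightarrow>\<^sub>E ({0..<N} \<rightarrow>\<^sub>E boson_labels r)"
        using a by (auto simp: hv grid_states_def PiE_iff bounded_labels_def)
      then obtain i j where ij: "i \<in> {1..r}" "j < N"
          "\<not> fused_admissible r (h i (j + 1)) (v (i - 1) j) (h i j) (v i j)"
        using a by (auto simp: hv grid_states_def states_def boundary_def)
      then have "?w i j (h i j) (v (i - 1) j) (h i (Suc j)) (v i j) = 0"
        by (simp add: fused_weight_def fused_admissible_def)
      then have "(\<Prod>j<N. ?w i j (h i j) (v (i - 1) j) (h i (Suc j)) (v i j)) = 0"
        using ij by (intro prod_zero) auto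
      then show "(case a of (h, v) \<Rightarrow>
          \<Prod>i\<in>{1..r}. \<Prod>j<N. ?w i j (h i j) (v (i - 1) j) (h i (Suc j)) (v i j)) = 0"
        unfolding hv prod.case using ij by (intro prod_zero) auto
    qed
  qed auto
  also have "\<dots> = path_sum (row_spins r (spins r))
      (\<lambda>j. column_sum r (bounded_labels r) (\<lambda>i. ?w i j) (?T j) (\<lambda>_. 0)) N
      (boundary r Color w1) (boundary r Dolor w2)"
    by (rule grid_sum_eq_path_sum) (use bd finite_spins finite_bounded_labels in auto)
  also have "(\<lambda>j. column_sum r (bounded_labels r) (\<lambda>i. ?w i j) (?T j) (\<lambda>_. 0)) =
      (\<lambda>j X Y. fused_column r t z (?T j) Y X)"
    by (simp add: fun_eq_iff fused_column_def column_sum_def)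
  finally show ?thesis .
qed

section \<open>Descents and the Bruhat order\<close>

definition inversions :: "nat \<Rightarrow> (nat \<Rightarrow> nat) \<Rightarrow> (nat \<times> nat) set" where
  "inversions r w = {(a, b). 1 \<le> a \<and> a < b \<and> b \<le> r \<and> w b < w a}"

lemma finite_inversions: "finite (inversions r w)"
  by (rule finite_subset[of _ "{1..r} \<times> {1..r}"]) (auto simp: inversions_def)

lemma simple_refl_permutes: "1 \<le> i \<Longrightarrow> i < r \<Longrightarrow> simple_refl i permutes {1..r}"
  by (intro permutes_swap_id) auto

lemma inv_simple_refl_comp:
  assumes "1 \<le> i" "i < r" "w permutes {1..r}"
  shows "inv (simple_refl i \<circ> w) = inv w \<circ> simple_refl i"
  using assms(3) simple_refl_permutes[OF assms(1,2)]
  by (simp add: o_inv_distrib permutes_bij inv_unique_comp)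

text \<open>Left multiplication exchanges the values \<open>i\<close> and \<open>i + 1\<close>;
  being adjacent, they keep their order relative to all other values, so only the pair of their own
  positions changes.\<close>

lemma card_inversions_simple_refl:
  assumes i: "1 \<le> i" "i < r" and w: "w permutes {1..r}" and less: "inv w i < inv w (Suc i)"
  shows "card (inversions r (simple_refl i \<circ> w)) = Suc (card (inversions r w))"
proof -
  define p q where "p = inv w i" and "q = inv w (Suc i)"
  have val: "w a = i \<longleftrightarrow> a = p" "w a = Suc i \<longleftrightarrow> a = q" for a
    unfolding p_def q_def by (metis permutes_inv_eq[OF w])+
  have "p \<in> {1..r}" "q \<in> {1..r}"
    using i permutes_in_image[OF permutes_inv[OF w]] by (auto simp: p_def q_def)
  moreover have "p < q" using less by (simp add: p_def q_def)
  ultimately have pq: "1 \<le> p" "p < q" "q \<le> r" by auto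
  have s: "simple_refl i (w b) < simple_refl i (w a) \<longleftrightarrow> w b < w a \<or> a = p \<and> b = q"
    if "a < b" for a b
  proof (cases "w a \<in> {i, Suc i} \<or> w b \<in> {i, Suc i}")
    case False
    then show ?thesis using val pq by (auto simp: transpose_def)
  next
    case True
    have inj: "w a \<noteq> w b" using that permutes_inj[OF w] by (auto dest: injD)
    show ?thesis
      using True that pq inj val[of a] val[of b]
      by (auto simp: transpose_def)
  qed
  have "inversions r (simple_refl i \<circ> w) = insert (p, q) (inversions r w)"
    unfolding inversions_def using s pq by auto
  moreover have "(p, q) \<notin> inversions r w"
    using val[of p] val[of q] by (simp add: inversions_def)
  ultimately show ?thesis by (simp add: finite_inversions)
qed

lemma permutes_inv_neq:
  "w permutes {1..r} \<Longrightarrow> inv w i \<noteq> inv w (Suc i)"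
  using permutes_inj[OF permutes_inv] by (metis injD n_not_Suc_n)

lemma card_inversions_simple_refl':
  assumes i: "1 \<le> i" "i < r" and w: "w permutes {1..r}" and less: "inv w (Suc i) < inv w i"
  shows "card (inversions r w) = Suc (card (inversions r (simple_refl i \<circ> w)))"
proof -
  have "simple_refl i \<circ> w permutes {1..r}"
    using w simple_refl_permutes[OF i] by (rule permutes_compose)
  moreover have "inv (simple_refl i \<circ> w) i < inv (simple_refl i \<circ> w) (Suc i)"
    using less by (simp add: inv_simple_refl_comp[OF i w])
  moreover have "simple_refl i \<circ> (simple_refl i \<circ> w) = w"
    by (simp add: fun_eq_iff)
  ultimately show ?thesis
    using card_inversions_simple_refl[OF i, of "simple_refl i \<circ> w"] by simp
qed

lemma permutes_id_if_increasing:
  assumes u: "u permutes {1..r}" and inc: "\<And>i. 1 \<le> i \<Longrightarrow> i < r \<Longrightarrow> u i < u (Suc i)"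
  shows "u = id"
proof (rule permutes_natset_ge[OF u])
  have "k \<le> u k" if "1 \<le> k" "k \<le> r" for k
    using that
  proof (induction k rule: dec_induct)
    case base
    then show ?case using permutes_in_image[OF u, of 1] by auto
  next
    case (step k)
    then show ?case using inc[of k] by simp
  qed
  then show "\<forall>i\<in>{1..r}. i \<le> u i" by simp
qed

text \<open>As long as the value \<open>i + 1\<close> stands before \<open>i\<close> for some
  \<open>i\<close>, a reflection removes one inversion; if there is no such \<open>i\<close>, then
  \<open>w\<close> is the identity.\<close>

lemma reduced_word_exists:
  assumes "w permutes {1..r}"
  shows "\<exists>js. length js = card (inversions r w) \<and> set js \<subseteq> {1..<r} \<and>
    w = foldr (\<lambda>j u. simple_refl j \<circ> u) js id"
  using assms
proof (induction "card (inversions r w)" arbitrary: w rule: less_induct)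
  case less
  show ?case
  proof (cases "\<exists>i. 1 \<le> i \<and> i < r \<and> inv w (Suc i) < inv w i")
    case True
    then obtain i where i: "1 \<le> i" "i < r" "inv w (Suc i) < inv w i" by auto
    have "simple_refl i \<circ> w permutes {1..r}"
      using less.prems simple_refl_permutes[OF i(1,2)] by (rule permutes_compose)
    with less.hyps[of "simple_refl i \<circ> w"] card_inversions_simple_refl'[OF i(1,2) less.prems i(3)]
    obtain js where js: "length js = card (inversions r (simple_refl i \<circ> w))" "set js \<subseteq> {1..<r}"
      "simple_refl i \<circ> w = foldr (\<lambda>j u. simple_refl j \<circ> u) js id" by auto
    have "foldr (\<lambda>j u. simple_refl j \<circ> u) (i # js) id = simple_refl i \<circ> (simple_refl i \<circ> w)"
      by (simp add: js(3))
    also have "\<dots> = w" by (simp add: fun_eq_iff)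
    finally show ?thesis
      using i js card_inversions_simple_refl'[OF i(1,2) less.prems i(3)]
      by (intro exI[of _ "i # js"]) auto
  next
    case False
    then have "inv w i < inv w (Suc i)" if "1 \<le> i" "i < r" for i
      using that permutes_inv_neq[OF less.prems, of i] by force
    then have "inv w = id"
      using permutes_id_if_increasing[OF permutes_inv[OF less.prems]] by blast
    then have "w = id" using permutes_inv_inv[OF less.prems] by simp
    moreover have "inversions r id = {}" by (auto simp: inversions_def)
    ultimately show ?thesis by (intro exI[of _ "[]"]) simp
  qed
qed

text \<open>Each letter creates at most one inversion, so no word is shorter than the number of
  inversions.\<close>

lemma inversions_word_le:
  assumes "set js \<subseteq> {1..<r}"
  shows "foldr (\<lambda>j u. simple_refl j \<circ> u) js id permutes {1..r} \<and>
    card (inversions r (foldr (\<lambda>j u. simple_refl j \<circ> u) js id)) \<le> length js"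
  using assms
proof (induction js)
  case Nil
  have "inversions r id = {}" by (auto simp: inversions_def)
  then show ?case using permutes_id[of "{1..r}"] by (simp add: id_def)
next
  case (Cons j js)
  let ?w = "foldr (\<lambda>j u. simple_refl j \<circ> u) js id"
  have j: "1 \<le> j" "j < r" and js: "set js \<subseteq> {1..<r}"
    using Cons.prems by auto
  note w = conjunct1[OF Cons.IH[OF js]] conjunct2[OF Cons.IH[OF js]]
  have "card (inversions r (simple_refl j \<circ> ?w)) \<le> Suc (card (inversions r ?w))"
    using card_inversions_simple_refl[OF j w(1)] card_inversions_simple_refl'[OF j w(1)]
      permutes_inv_neq[OF w(1), of j] by linarith
  then have "card (inversions r (simple_refl j \<circ> ?w)) \<le> length (j # js)"
    using w(2) unfolding length_Cons by linarith
  moreover have "simple_refl j \<circ> ?w permutes {1..r}"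
    using w(1) simple_refl_permutes[OF j] by (rule permutes_compose)
  moreover have "foldr (\<lambda>j u. simple_refl j \<circ> u) (j # js) id = simple_refl j \<circ> ?w"
    by simp
  ultimately show ?case by metis
qed

lemma coxeter_length_eq_card_inversions:
  assumes "w permutes {1..r}"
  shows "coxeter_length r w = card (inversions r w)"
  unfolding coxeter_length_def
  by (rule Least_equality) (use reduced_word_exists[OF assms] inversions_word_le in auto)

lemma bruhat_less_coxeter_length:
  "bruhat_less r u w \<Longrightarrow> coxeter_length r u < coxeter_length r w"
  unfolding bruhat_less_def by (induction rule: tranclp_induct) (auto simp: bruhat_step_def)

text \<open>The Bruhat order enters through the length alone, and the effect of a simple reflection
  on the length is read off the positions of \<open>i\<close> and \<open>i + 1\<close>.\<close>

lemma bruhat_less_simple_refl: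
  assumes i: "1 \<le> i" "i < r" and w: "w permutes {1..r}"
  shows "bruhat_less r w (simple_refl i \<circ> w) \<Longrightarrow> inv w i < inv w (Suc i)"
    and "bruhat_less r (simple_refl i \<circ> w) w \<Longrightarrow> inv w (Suc i) < inv w i"
proof -
  have sw: "simple_refl i \<circ> w permutes {1..r}"
    using w simple_refl_permutes[OF i] by (rule permutes_compose)
  note len = coxeter_length_eq_card_inversions[OF w] coxeter_length_eq_card_inversions[OF sw]
  show "inv w i < inv w (Suc i)" if "bruhat_less r w (simple_refl i \<circ> w)"
    using bruhat_less_coxeter_length[OF that] card_inversions_simple_refl'[OF i w] len
      permutes_inv_neq[OF w, of i] by linarith
  show "inv w (Suc i) < inv w i" if "bruhat_less r (simple_refl i \<circ> w) w"
    using bruhat_less_coxeter_length[OF that] card_inversions_simple_refl[OF i w] len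
      permutes_inv_neq[OF w, of i] by linarith
qed

section \<open>Exchanging two rows\<close>

text \<open>The middle edge is forced. Its value is at most \<open>r + (i - 1) + 1\<close>, so it
  lies within the truncated range and exactly one term survives.\<close>

lemma two_row_sum:
  assumes "n \<in> {0..r + (i - 1)}" "1 \<le> i"
  shows "(\<Sum>m\<in>{0..r + i}. unfused_vertex t z1 p x n X m * unfused_vertex t z2 p y m Y n') =
    two_row_weight t z1 z2 p (\<lambda>k. if n' = k then 1 else 0) n x y X Y"
proof -
  have "boson_out x n X \<in> {0..r + i}"
    using boson_out_le[of x n X] assms by auto
  then show ?thesis
    by (simp add: unfused_vertex_eq two_row_weight_def if_distrib[of "\<lambda>c. c * _"] sum.delta cong: if_cong)
qed

lemma mem_spins [simp]:
  "Color a \<in> spins r \<longleftrightarrow> 1 \<le> a \<and> a \<le> r" "Dolor a \<in> spins r \<longleftrightarrow> 1 \<le> a \<and> a \<le> r"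
  by (auto simp: spins_def)

text \<open>At \<open>c = r + 1\<close> every color has been passed, so the color order is unrotated
  again; the dolor \<open>d + 1\<close> has been passed as well, which leaves the set of dolors
  above \<open>d\<close>.\<close>

lemma R_keep_wrap:
  assumes "x \<in> spins r" "y \<in> spins r"
  shows "R_keep t z1 z2 (Suc r) (Suc d) x y = R_keep t z1 z2 1 d x y"
proof -
  have "d < a \<longleftrightarrow> Suc d < a \<or> a = Suc d" for a by auto
  then show ?thesis
    using assms by (cases x; cases y) (simp_all add: not_le less_Suc_eq_le Suc_le_eq)
qed

text \<open>Whether all dolors have been passed or none, no two of them are separated.\<close>

lemma R_keep_0:
  assumes "x \<in> spins r" "y \<in> spins r"
  shows "R_keep t z1 z2 1 0 x y = R_keep t z1 z2 1 r x y"
  using assms by (cases x; cases y) (simp_all add: not_le Suc_le_eq)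

lemma unfused_column_exchange:
  fixes t :: "'a::comm_ring_1" and z :: "nat \<Rightarrow> 'a" and r c d T B :: nat
  defines "C \<equiv> \<lambda>z. column_sum r (\<lambda>i. {0..r + i}) (\<lambda>i. unfused_vertex t (z i) (c, d)) T B"
  assumes i: "1 \<le> i" "i < r" and "c \<ge> 1"
    and X: "X \<in> row_spins r (spins r)" and Y: "Y \<in> row_spins r (spins r)"
  shows "R_keep t (z i) (z (Suc i)) c d (X i) (X (Suc i)) * C z X Y +
         R_swap t (z i) (z (Suc i)) (X i) (X (Suc i)) * C z (X \<circ> simple_refl i) Y =
         R_keep t (z i) (z (Suc i)) (Suc c) d (Y i) (Y (Suc i)) * C (z \<circ> simple_refl i) X Y +
         R_swap t (z i) (z (Suc i)) (Y (Suc i)) (Y i) * C (z \<circ> simple_refl i) X (Y \<circ> simple_refl i)"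
  unfolding C_def
proof (rule column_sum_exchange[OF i _ _ X Y, where b = "R_swap t (z i) (z (Suc i))"])
  fix n n' :: nat and x y x' y'
  assume n: "n \<in> {0..r + (i - 1)}" and "x \<in> spins r" "y \<in> spins r"
  then show "R_keep t (z i) (z (Suc i)) c d x y *
      (\<Sum>m\<in>{0..r + i}. unfused_vertex t (z i) (c, d) x n x' m * unfused_vertex t (z (Suc i)) (c, d) y m y' n') +
    R_swap t (z i) (z (Suc i)) x y *
      (\<Sum>m\<in>{0..r + i}. unfused_vertex t (z i) (c, d) y n x' m * unfused_vertex t (z (Suc i)) (c, d) x m y' n') =
    R_keep t (z i) (z (Suc i)) (Suc c) d x' y' *
      (\<Sum>m\<in>{0..r + i}. unfused_vertex t ((z \<circ> simple_refl i) i) (c, d) x n x' m *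
         unfused_vertex t ((z \<circ> simple_refl i) (Suc i)) (c, d) y m y' n') +
    R_swap t (z i) (z (Suc i)) y' x' *
      (\<Sum>m\<in>{0..r + i}. unfused_vertex t ((z \<circ> simple_refl i) i) (c, d) x n y' m *
         unfused_vertex t ((z \<circ> simple_refl i) (Suc i)) (c, d) y m x' n')"
    using yang_baxter[OF \<open>c \<ge> 1\<close>] by (simp add: two_row_sum[OF n i(1)] del: R_keep.simps)
qed (auto simp: transpose_def)

lemma row_spins_swap:
  assumes "1 \<le> i" "i < r" "X \<in> row_spins r S"
  shows "X \<circ> simple_refl i \<in> row_spins r S"
proof -
  have "simple_refl i j \<in> {1..r} \<longleftrightarrow> j \<in> {1..r}" for j
    by (rule permutes_in_image[OF simple_refl_permutes[OF assms(1,2)]])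
  then show ?thesis
    using assms(3)
    by (auto simp: row_spins_def PiE_iff extensional_def)
qed

lemma fused_column_exchange:
  fixes t :: "'a::comm_ring_1" and z :: "nat \<Rightarrow> 'a"
  assumes i: "1 \<le> i" "i < r" and T: "T \<in> boson_labels r"
    and X: "X \<in> row_spins r (spins r)" and Y: "Y \<in> row_spins r (spins r)"
  shows "R_keep t (z i) (z (Suc i)) 1 r (X i) (X (Suc i)) * fused_column r t z T X Y +
         R_swap t (z i) (z (Suc i)) (X i) (X (Suc i)) * fused_column r t z T (X \<circ> simple_refl i) Y =
         R_keep t (z i) (z (Suc i)) 1 r (Y i) (Y (Suc i)) * fused_column r t (z \<circ> simple_refl i) T X Y +
         R_swap t (z i) (z (Suc i)) (Y (Suc i)) (Y i) *
           fused_column r t (z \<circ> simple_refl i) T X (Y \<circ> simple_refl i)"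
proof -
  let ?U = "row_spins r (spins r)" and ?s = "\<lambda>X. X \<circ> simple_refl i"
  define C where "C = (\<lambda>z k. let p = color_dolor_pairs r ! k in
    column_sum r (\<lambda>i. {0..r + i}) (\<lambda>i. unfused_vertex t (z i) p) (T p) 0)"
  define a where "a k X = R_keep t (z i) (z (Suc i)) (k mod r + 1) (r - k div r) (X i) (X (Suc i))"
    for k and X :: "nat \<Rightarrow> spin"
  define b where "b X = R_swap t (z i) (z (Suc i)) (X i) (X (Suc i))" for X :: "nat \<Rightarrow> spin"
  define b' where "b' X = R_swap t (z i) (z (Suc i)) (X (Suc i)) (X i)" for X :: "nat \<Rightarrow> spin"
  have S: "X i \<in> spins r \<and> X (Suc i) \<in> spins r" if "X \<in> ?U" for X
    using that i by (auto simp: row_spins_def)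
  have col: "fused_column r t z T X Y = path_sum ?U (C z) (r\<^sup>2) X Y"
    if "X \<in> ?U" "Y \<in> ?U" for X Y and z :: "nat \<Rightarrow> 'a"
    unfolding fused_column_def C_def
    by (rule fused_column_eq_path_sum[OF that T]) (simp add: boson_labels_def)
  have step: "a k X * C z k X Y + b X * C z k (?s X) Y =
      a (Suc k) Y * C (?s z) k X Y + b' Y * C (?s z) k X (?s Y)"
    if k: "k < r\<^sup>2" and XY: "X \<in> ?U" "Y \<in> ?U" for k X Y
  proof -
    \<comment> \<open>The right-hand label of vertex \<open>k\<close> is the left-hand label of
      vertex \<open>k + 1\<close>, with a wrap at the last color.\<close>
    have next': "R_keep t (z i) (z (Suc i)) (Suc (k mod r + 1)) (r - k div r) (Y i) (Y (Suc i)) = a (Suc k) Y"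
    proof (cases "Suc (k mod r) = r")
      case True
      have "k div r < r" using k by (simp add: power2_eq_square less_mult_imp_div_less)
      moreover have mod: "Suc k mod r = 0" using True by (simp add: mod_Suc)
      ultimately have "r - k div r = Suc (r - Suc k div r)"
        by (simp add: div_Suc)
      then show ?thesis
        using True mod R_keep_wrap[of "Y i" r "Y (Suc i)"] S[OF XY(2)] by (simp add: a_def del: R_keep.simps)
    next
      case False
      then show ?thesis by (simp add: a_def mod_Suc div_Suc del: R_keep.simps)
    qed
    show ?thesis
      using unfused_column_exchange[OF i _ XY, of "k mod r + 1" t z "r - k div r"
          "T (color_dolor_pairs r ! k)" 0]
      by (simp add: C_def Let_def color_dolor_pairs_nth[OF k] b_def b'_def flip: next' del: R_keep.simps)
         (simp add: a_def del: R_keep.simps)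
  qed
  have "a 0 X * path_sum ?U (C z) (r\<^sup>2) X Y + b X * path_sum ?U (C z) (r\<^sup>2) (?s X) Y =
    a (r\<^sup>2) Y * path_sum ?U (C (?s z)) (r\<^sup>2) X Y + b' Y * path_sum ?U (C (?s z)) (r\<^sup>2) X (?s Y)"
  proof (rule path_sum_train[where s = ?s and a = a and b = b and b' = b', OF _ _ _ step X Y])
    fix X :: "nat \<Rightarrow> spin"
    show "?s X \<in> ?U" if "X \<in> ?U" using that row_spins_swap[OF i] by blast
    show "?s (?s X) = X" by (simp add: fun_eq_iff)
    show "b' (?s X) = b X" by (simp add: b_def b'_def)
  qed
  moreover have "a 0 X = R_keep t (z i) (z (Suc i)) 1 r (X i) (X (Suc i))"
    using i by (simp add: a_def del: R_keep.simps)
  \<comment> \<open>The train ends at the label \<open>(1, 0)\<close>, which agrees with its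
    starting label \<open>(1, r)\<close>.\<close>
  moreover have "a (r\<^sup>2) Y = R_keep t (z i) (z (Suc i)) 1 r (Y i) (Y (Suc i))"
    using i S[OF Y] R_keep_0[of "Y i" r "Y (Suc i)"]
    by (simp add: a_def power2_eq_square del: R_keep.simps)
  ultimately show ?thesis
    using X Y row_spins_swap[OF i X] row_spins_swap[OF i Y]
    by (simp add: col b_def b'_def del: R_keep.simps)
qed

lemma boundary_swap:
  assumes "1 \<le> i" "i < r" "w permutes {1..r}"
  shows "boundary r f (simple_refl i \<circ> w) = boundary r f w \<circ> simple_refl i"
proof -
  have "simple_refl i j \<in> {1..r} \<longleftrightarrow> j \<in> {1..r}" for j
    by (rule permutes_in_image[OF simple_refl_permutes[OF assms(1,2)]])
  then show ?thesis
    using inv_simple_refl_comp[OF assms] by (auto simp: boundary_def fun_eq_iff)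
qed

lemma partition_function_exchange:
  fixes t :: "'a::comm_ring_1" and z :: "nat \<Rightarrow> 'a" and r N :: nat and lam w3 w4 :: "nat \<Rightarrow> nat"
  defines "Z \<equiv> \<lambda>w1 w2. partition_function r N lam w1 w2 w3 w4 t"
  assumes i: "1 \<le> i" "i < r"
    and w: "w1 permutes {1..r}" "w2 permutes {1..r}" "w3 permutes {1..r}" "w4 permutes {1..r}"
  shows "R_keep t (z i) (z (Suc i)) 1 r (Dolor (inv w2 i)) (Dolor (inv w2 (Suc i))) * Z w1 w2 z +
    R_swap t (z i) (z (Suc i)) (Dolor (inv w2 i)) (Dolor (inv w2 (Suc i))) * Z w1 (simple_refl i \<circ> w2) z =
    R_keep t (z i) (z (Suc i)) 1 r (Color (inv w1 i)) (Color (inv w1 (Suc i))) * Z w1 w2 (z \<circ> simple_refl i) +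
    R_swap t (z i) (z (Suc i)) (Color (inv w1 (Suc i))) (Color (inv w1 i)) *
      Z (simple_refl i \<circ> w1) w2 (z \<circ> simple_refl i)"
proof -
  let ?U = "row_spins r (spins r)" and ?s = "\<lambda>X. X \<circ> simple_refl i"
  define D where "D z j X Y = fused_column r t z (top_boundary r lam w3 w4 j) Y X" for z :: "nat \<Rightarrow> 'a" and j X Y
  define a where "a X = R_keep t (z i) (z (Suc i)) 1 r (X i) (X (Suc i))" for X :: "nat \<Rightarrow> spin"
  define b where "b X = R_swap t (z i) (z (Suc i)) (X (Suc i)) (X i)" for X :: "nat \<Rightarrow> spin"
  define b' where "b' X = R_swap t (z i) (z (Suc i)) (X i) (X (Suc i))" for X :: "nat \<Rightarrow> spin"
  let ?X = "boundary r Color w1" and ?Y = "boundary r Dolor w2"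
  have sw: "simple_refl i \<circ> w permutes {1..r}" if "w permutes {1..r}" for w
    using that simple_refl_permutes[OF i] by (rule permutes_compose)
  have Z: "Z w1 w2 z = path_sum ?U (D z) N (boundary r Color w1) (boundary r Dolor w2)"
    if "w1 permutes {1..r}" "w2 permutes {1..r}" for w1 w2 and z :: "nat \<Rightarrow> 'a"
    unfolding Z_def D_def by (rule partition_function_eq_path_sum) (use that w in auto)
  have inv: "inv w i \<in> {1..r}" if "w permutes {1..r}" "i \<in> {1..r}" for w i
    using that by (metis permutes_in_image permutes_inv)
  have bd: "?X \<in> ?U" "?Y \<in> ?U"
    using inv w by (auto simp: boundary_def row_spins_def spins_def)
  \<comment> \<open>The path runs from right to left, against the columns. So the system at
    \<open>?s z\<close> comes first, and \<open>b\<close> and \<open>b'\<close> trade places. The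
    entry \<open>a\<close> is constant because each fused column restores the R-matrix.\<close>
  have "a ?X * path_sum ?U (D (?s z)) N ?X ?Y + b ?X * path_sum ?U (D (?s z)) N (?s ?X) ?Y =
    a ?Y * path_sum ?U (D z) N ?X ?Y + b' ?Y * path_sum ?U (D z) N ?X (?s ?Y)"
  proof (rule path_sum_train[where s = ?s and a = "\<lambda>_. a" and b' = b', OF _ _ _ _ bd])
    fix X :: "nat \<Rightarrow> spin"
    show "?s X \<in> ?U" if "X \<in> ?U" using that row_spins_swap[OF i] by blast
    show "?s (?s X) = X" by (simp add: fun_eq_iff)
    show "b' (?s X) = b X" by (simp add: b_def b'_def)
  next
    fix j X Y assume "X \<in> ?U" "Y \<in> ?U"
    moreover have "top_boundary r lam w3 w4 j \<in> boson_labels r"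
      using top_boundary_bounded_labels[OF w(3,4)] by (auto simp: bounded_labels_def)
    ultimately show "a X * D (?s z) j X Y + b X * D (?s z) j (?s X) Y =
      a Y * D z j X Y + b' Y * D z j X (?s Y)"
      using fused_column_exchange[OF i, of "top_boundary r lam w3 w4 j" Y X t z]
      by (simp add: D_def a_def b_def b'_def del: R_keep.simps)
  qed
  moreover have "?X i = Color (inv w1 i)" "?X (Suc i) = Color (inv w1 (Suc i))"
    "?Y i = Dolor (inv w2 i)" "?Y (Suc i) = Dolor (inv w2 (Suc i))"
    using i by (simp_all add: boundary_def)
  ultimately show ?thesis
    using w sw i by (simp add: Z boundary_swap a_def b_def b'_def del: R_keep.simps)
qed

section \<open>Divided differences of the partition function\<close>

lemma swap_vars_add: "swap_vars i (f + g) = swap_vars i f + swap_vars i g"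
  by (cases f rule: Fract_cases; cases g rule: Fract_cases)
     (simp add: swap_vars_Fract swap_poly_add swap_poly_mult)

lemma swap_vars_mult: "swap_vars i (f * g) = swap_vars i f * swap_vars i g"
  by (cases f rule: Fract_cases; cases g rule: Fract_cases)
     (simp add: swap_vars_Fract swap_poly_mult)

lemma swap_monom_0: "swap_monom i 0 = 0"
  by (metis add_cancel_right_right swap_monom_add)

lemma swap_poly_1: "swap_poly i 1 = 1"
  by (simp only: single_one[symmetric] swap_poly_single swap_monom_0)

lemma swap_vars_1: "swap_vars i 1 = 1"
  by (simp add: One_fract_def swap_vars_Fract swap_poly_1)

lemma swap_vars_t_ind: "swap_vars i t_ind = t_ind"
  by (simp add: t_ind_def swap_vars_Fract swap_poly_single swap_poly_1 swap_monom_0)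

lemma swap_vars_z_ind: "swap_vars i (z_ind j) = z_ind (simple_refl i j)"
proof -
  have "swap_monom i (Poly_Mapping.single j 1) = Poly_Mapping.single (simple_refl i j) 1"
    using map_key_single[OF inj_simple_refl, of i "simple_refl i j" "1::nat"] by (simp add: swap_monom_def)
  then show ?thesis
    by (simp add: z_ind_def swap_vars_Fract swap_poly_single swap_poly_1)
qed

lemma swap_vars_swap_vars: "swap_vars i (swap_vars i f) = f"
  by (cases f rule: Fract_cases) (simp add: swap_vars_Fract)

lemma z_ind_eq_iff: "z_ind i = z_ind j \<longleftrightarrow> i = j"
proof
  assume "z_ind i = z_ind j"
  then have "Poly_Mapping.single (Poly_Mapping.single i 1) 1 =
      (Poly_Mapping.single (Poly_Mapping.single j 1) 1 :: zpoly)"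
    by (simp add: z_ind_def eq_fract)
  then have "Poly_Mapping.keys (Poly_Mapping.single (Poly_Mapping.single i 1) 1 :: zpoly) =
      Poly_Mapping.keys (Poly_Mapping.single (Poly_Mapping.single j 1) 1 :: zpoly)"
    by (rule arg_cong)
  then have "Poly_Mapping.single i (1::nat) = Poly_Mapping.single j 1" by simp
  then have "Poly_Mapping.keys (Poly_Mapping.single i (1::nat)) = Poly_Mapping.keys (Poly_Mapping.single j (1::nat))"
    by (rule arg_cong)
  then show "i = j" by simp
qed simp

lemma z_ind_nonzero: "z_ind i \<noteq> 0"
proof
  assume "z_ind i = 0"
  then have "Poly_Mapping.single (Poly_Mapping.single i 1) 1 = (0 :: zpoly)"
    by (simp add: z_ind_def Zero_fract_def eq_fract)
  then have "Poly_Mapping.keys (Poly_Mapping.single (Poly_Mapping.single i 1) 1 :: zpoly) = Poly_Mapping.keys (0 :: zpoly)"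
    by (rule arg_cong)
  then show False by simp
qed

lemma t_ind_neq_1: "t_ind \<noteq> 1"
proof
  assume "t_ind = 1"
  then have "Poly_Mapping.single 0 (Fract [:0, 1:] 1) = (1 :: zpoly)"
    by (simp add: t_ind_def One_fract_def eq_fract)
  then have "Poly_Mapping.lookup (Poly_Mapping.single 0 (Fract [:0, 1:] 1) :: zpoly) 0 = Poly_Mapping.lookup 1 0"
    by simp
  then have "Fract [:0, 1:] 1 = (Fract 1 1 :: rat poly fract)"
    by (simp add: lookup_one One_fract_def)
  then show False by (simp add: eq_fract one_pCons)
qed

text \<open>Partition functions use only ring operations on \<open>t\<close> and \<open>z\<close>,
  so every homomorphism passes through them; for \<open>swap_vars i\<close> this identifies
  \<open>s\<^sub>i Z(z)\<close> with \<open>Z(s\<^sub>i z)\<close>.\<close>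

locale comm_ring_hom =
  fixes f :: "'a::comm_ring_1 \<Rightarrow> 'b::comm_ring_1"
  assumes add: "f (x + y) = f x + f y" and mult: "f (x * y) = f x * f y" and one: "f 1 = 1"
begin

lemma zero: "f 0 = 0"
  using add[of 0 0] by simp

lemma diff: "f (x - y) = f x - f y"
  using add[of "x - y" y] by (simp add: algebra_simps)

lemma power: "f (x ^ n) = f x ^ n"
  by (induction n) (simp_all add: one mult)

lemma sum: "f (\<Sum>x\<in>A. g x) = (\<Sum>x\<in>A. f (g x))"
  by (induction A rule: infinite_finite_induct) (simp_all add: zero add)

lemma prod: "f (\<Prod>x\<in>A. g x) = (\<Prod>x\<in>A. f (g x))"
  by (induction A rule: infinite_finite_induct) (simp_all add: one mult)

lemma unfused_weight: "f (unfused_weight t z p x n y m) = unfused_weight (f t) (f z) p x n y m"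
  by (cases p; cases x; cases y) (simp_all add: one mult power sum diff)

lemma fused_weight: "f (fused_weight r t z x T y B) = fused_weight r (f t) (f z) x T y B"
  by (simp add: fused_weight_def sum prod unfused_weight Let_def)

lemma partition_function:
  "f (partition_function r N lam w1 w2 w3 w4 t z) =
     partition_function r N lam w1 w2 w3 w4 (f t) (f \<circ> z)"
  by (simp add: partition_function_def sum prod fused_weight case_prod_unfold)

end

interpretation swap_vars: comm_ring_hom "swap_vars i" for i
  by unfold_locales (rule swap_vars_add swap_vars_mult swap_vars_1)+

section \<open>Relations between the four operators\<close>

context
  fixes i :: nat and k z1 z2 :: ratfun
  defines "k \<equiv> inverse (z_ind i - z_ind (Suc i))" and "z1 \<equiv> z_ind i" and "z2 \<equiv> z_ind (Suc i)"
begin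

lemma z_diff_inverse: "k * (z1 - z2) = 1"
  by (simp add: k_def z1_def z2_def z_ind_eq_iff)

lemma swap_vars_z_diff_inverse: "swap_vars i k = - k"
proof -
  have "swap_vars i k * (z2 - z1) = 1"
    using arg_cong[OF z_diff_inverse, of "swap_vars i"]
    by (simp add: swap_vars_mult swap_vars.diff swap_vars_1 swap_vars_z_ind z1_def z2_def)
  then show ?thesis using z_diff_inverse by algebra
qed

lemma swap_vars_z: "swap_vars i z1 = z2" "swap_vars i z2 = z1"
  by (simp_all add: swap_vars_z_ind z1_def z2_def)

lemma D_eq:
  "D1 i f = k * (z1 * f - z1 * swap_vars i f)"
  "D2 i f = k * (z1 * f - z2 * swap_vars i f)"
  "D3 i f = k * (z2 * f - z1 * swap_vars i f)"
  "D4 i f = k * (z2 * f - z2 * swap_vars i f)"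
  by (simp_all add: D1_def D2_def D3_def D4_def k_def z1_def z2_def)

lemma swap_vars_D:
  "swap_vars i (D1 i f) = - k * (z2 * swap_vars i f - z2 * f)"
  "swap_vars i (D2 i f) = - k * (z2 * swap_vars i f - z1 * f)"
  "swap_vars i (D3 i f) = - k * (z1 * swap_vars i f - z2 * f)"
  "swap_vars i (D4 i f) = - k * (z1 * swap_vars i f - z1 * f)"
  by (simp_all only: D_eq swap_vars_mult swap_vars.diff swap_vars_z_diff_inverse swap_vars_z swap_vars_swap_vars)

lemma D_idempotent:
  "D1 i (D1 i f) = D1 i f" "D2 i (D2 i f) = D2 i f"
  "D3 i (D3 i f) = - D3 i f" "D4 i (D4 i f) = - D4 i f"
  \<comment> \<open>Only the outer operator is opened at first, so that \<open>swap_vars_D\<close>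
    applies to the inner one. What remains is polynomial in \<open>f\<close>,
    \<open>swap_vars i f\<close>, \<open>k\<close>, \<open>z1\<close>, \<open>z2\<close> modulo
    \<open>k * (z1 - z2) = 1\<close>.\<close>
  unfolding D_eq(1)[of "D1 i f"] D_eq(2)[of "D2 i f"] D_eq(3)[of "D3 i f"] D_eq(4)[of "D4 i f"]
    swap_vars_D unfolding D_eq using z_diff_inverse by algebra+

lemma D_annihilate:
  "D1 i (D2 i f) = 0" "D1 i (D3 i f) = 0" "D2 i (D4 i f) = 0"
  "D3 i (D1 i f) = 0" "D4 i (D2 i f) = 0" "D4 i (D3 i f) = 0"
  unfolding D_eq(1)[of "D2 i f"] D_eq(1)[of "D3 i f"] D_eq(2)[of "D4 i f"]
    D_eq(3)[of "D1 i f"] D_eq(4)[of "D2 i f"] D_eq(4)[of "D3 i f"]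
    swap_vars_D unfolding D_eq using z_diff_inverse by algebra+

end

text \<open>At the position \<open>(1, r)\<close> nothing is rotated. The reversed arguments for
  colors undo the reversal in \<open>spin_less\<close>, so \<open>a < b\<close> governs all four
  entries.\<close>

lemma R_boundary:
  fixes z1 z2 t :: "'a::comm_ring_1"
  assumes "1 \<le> a" "a \<le> r" "1 \<le> b" "b \<le> r" "a \<noteq> b"
  shows
    "R_keep t z1 z2 1 r (Dolor a) (Dolor b) = z1 * z2 * ((1 - t) * (if a < b then z2 else z1))"
    "R_keep t z1 z2 1 r (Color a) (Color b) = z1 * z2 * ((1 - t) * (if a < b then z2 else z1))"
    "R_swap t z1 z2 (Dolor a) (Dolor b) = z1 * z2 * ((z1 - z2) * (if a < b then t else 1))"
    "R_swap t z1 z2 (Color b) (Color a) = z1 * z2 * ((z1 - z2) * (if a < b then t else 1))"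
  using assms by (simp_all add: R_swap_def mult.assoc)

text \<open>Here \<open>a\<close>, \<open>b\<close> will be \<open>z1\<close> or \<open>z2\<close>,
  and \<open>p\<close>, \<open>q\<close> will be 1 or \<open>t\<close>; the four combinations yield
  the four operators.\<close>

lemma divided_difference_eq:
  fixes f g P Q :: ratfun
  assumes eq: "z1 * z2 * ((1 - t) * a) * f + z1 * z2 * ((z1 - z2) * p) * P =
      z1 * z2 * ((1 - t) * b) * g + z1 * z2 * ((z1 - z2) * q) * Q"
    and "z1 \<noteq> 0" "z2 \<noteq> 0" "z1 \<noteq> z2" "t \<noteq> 1"
  shows "inverse (z1 - z2) * (a * f - b * g) = inverse (1 - t) * (q * Q - p * P)"
proof -
  have "z1 * z2 * ((1 - t) * (a * f - b * g)) = z1 * z2 * ((z1 - z2) * (q * Q - p * P))"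
    using eq by (simp add: algebra_simps)
  then have "(1 - t) * (a * f - b * g) = (z1 - z2) * (q * Q - p * P)"
    using assms(2,3) by simp
  then show ?thesis
    using assms(4,5) by (simp add: field_simps)
qed

theorem corollary5p2:
  fixes r N i :: nat and lam w3 w4 :: "nat \<Rightarrow> nat"
    and Z :: "(nat \<Rightarrow> nat) \<Rightarrow> (nat \<Rightarrow> nat) \<Rightarrow> (nat \<Rightarrow> ratfun) \<Rightarrow> ratfun"
  assumes "1 \<le> r" and "1 \<le> N"
    and "\<And>j k. 1 \<le> j \<Longrightarrow> j \<le> k \<Longrightarrow> k \<le> r \<Longrightarrow> lam k \<le> lam j"
    and "lam 1 < N"
    and "w3 permutes {1..r}" and "w4 permutes {1..r}"
    and Z_def: "Z = (\<lambda>w1 w2. partition_function r N lam w1 w2 w3 w4 t_ind)"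
    and "1 \<le> i" and "i \<le> r - 1"
  shows
    "(\<forall>f. D1 i (D1 i f) = D1 i f) \<and> (\<forall>f. D2 i (D2 i f) = D2 i f) \<and>
     (\<forall>f. D3 i (D3 i f) = - D3 i f) \<and> (\<forall>f. D4 i (D4 i f) = - D4 i f) \<and>
     (\<forall>f. D1 i (D2 i f) = 0 \<and> D1 i (D3 i f) = 0 \<and> D2 i (D4 i f) = 0 \<and>
          D3 i (D1 i f) = 0 \<and> D4 i (D2 i f) = 0 \<and> D4 i (D3 i f) = 0) \<and>
     (\<forall>w1 w2. w1 permutes {1..r} \<longrightarrow> w2 permutes {1..r} \<longrightarrow>
       (let s = simple_refl i; z = z_ind; sz = z_ind \<circ> simple_refl i; t = t_ind;
            less = bruhat_less r
        in
         (less (s \<circ> w1) w1 \<and> less (s \<circ> w2) w2 \<longrightarrow>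
            D1 i (Z w1 w2 z) = inverse (1 - t) * (Z (s \<circ> w1) w2 sz - Z w1 (s \<circ> w2) z)) \<and>
         (less w1 (s \<circ> w1) \<and> less (s \<circ> w2) w2 \<longrightarrow>
            D2 i (Z w1 w2 z) = inverse (1 - t) * (t * Z (s \<circ> w1) w2 sz - Z w1 (s \<circ> w2) z)) \<and>
         (less (s \<circ> w1) w1 \<and> less w2 (s \<circ> w2) \<longrightarrow>
            D3 i (Z w1 w2 z) = inverse (1 - t) * (Z (s \<circ> w1) w2 sz - t * Z w1 (s \<circ> w2) z)) \<and>
         (less w1 (s \<circ> w1) \<and> less w2 (s \<circ> w2) \<longrightarrow>
            D4 i (Z w1 w2 z) = inverse (1 - t) * (t * Z (s \<circ> w1) w2 sz - t * Z w1 (s \<circ> w2) z))))"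
proof -
  have i: "1 \<le> i" "i < r" using assms(8,9) by auto
  have nz: "z_ind i \<noteq> 0" "z_ind (Suc i) \<noteq> 0" "z_ind i \<noteq> z_ind (Suc i)" "t_ind \<noteq> 1"
    by (simp_all add: z_ind_nonzero z_ind_eq_iff t_ind_neq_1)
  have swap: "swap_vars i (Z w1 w2 z_ind) = Z w1 w2 (z_ind \<circ> simple_refl i)" for w1 w2
    by (simp add: Z_def swap_vars.partition_function swap_vars_t_ind swap_vars_z_ind comp_def)
  have inv: "1 \<le> inv w j" "inv w j \<le> r" if "w permutes {1..r}" "j \<in> {1..r}" for w j
    using that permutes_in_image[OF permutes_inv[OF that(1)], of j] by auto
  have main: "(bruhat_less r (simple_refl i \<circ> w1) w1 \<and> bruhat_less r (simple_refl i \<circ> w2) w2 \<longrightarrow>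
      D1 i (Z w1 w2 z_ind) = inverse (1 - t_ind) *
        (Z (simple_refl i \<circ> w1) w2 (z_ind \<circ> simple_refl i) - Z w1 (simple_refl i \<circ> w2) z_ind)) \<and>
    (bruhat_less r w1 (simple_refl i \<circ> w1) \<and> bruhat_less r (simple_refl i \<circ> w2) w2 \<longrightarrow>
      D2 i (Z w1 w2 z_ind) = inverse (1 - t_ind) *
        (t_ind * Z (simple_refl i \<circ> w1) w2 (z_ind \<circ> simple_refl i) - Z w1 (simple_refl i \<circ> w2) z_ind)) \<and>
    (bruhat_less r (simple_refl i \<circ> w1) w1 \<and> bruhat_less r w2 (simple_refl i \<circ> w2) \<longrightarrow>
      D3 i (Z w1 w2 z_ind) = inverse (1 - t_ind) *
        (Z (simple_refl i \<circ> w1) w2 (z_ind \<circ> simple_refl i) - t_ind * Z w1 (simple_refl i \<circ> w2) z_ind)) \<and>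
    (bruhat_less r w1 (simple_refl i \<circ> w1) \<and> bruhat_less r w2 (simple_refl i \<circ> w2) \<longrightarrow>
      D4 i (Z w1 w2 z_ind) = inverse (1 - t_ind) *
        (t_ind * Z (simple_refl i \<circ> w1) w2 (z_ind \<circ> simple_refl i) -
         t_ind * Z w1 (simple_refl i \<circ> w2) z_ind))"
    if w: "w1 permutes {1..r}" "w2 permutes {1..r}" for w1 w2
  proof -
    let ?s = "simple_refl i"
    have in_range: "i \<in> {1..r}" "Suc i \<in> {1..r}" using i by auto
    note R1 = R_boundary[OF inv[OF w(1) in_range(1)] inv[OF w(1) in_range(2)] permutes_inv_neq[OF w(1)]]
    note R2 = R_boundary[OF inv[OF w(2) in_range(1)] inv[OF w(2) in_range(2)] permutes_inv_neq[OF w(2)]]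
    note up = bruhat_less_simple_refl(1)[OF i w(1)] bruhat_less_simple_refl(1)[OF i w(2)]
    note down = bruhat_less_simple_refl(2)[OF i w(1), THEN less_not_sym]
      bruhat_less_simple_refl(2)[OF i w(2), THEN less_not_sym]
    \<comment> \<open>One identity with its case distinctions left open; each pair of Bruhat
      comparisons settles them and gives one formula.\<close>
    have exchange: "inverse (z_ind i - z_ind (Suc i)) *
        ((if inv w2 i < inv w2 (Suc i) then z_ind (Suc i) else z_ind i) * Z w1 w2 z_ind -
         (if inv w1 i < inv w1 (Suc i) then z_ind (Suc i) else z_ind i) * swap_vars i (Z w1 w2 z_ind)) =
      inverse (1 - t_ind) *
        ((if inv w1 i < inv w1 (Suc i) then t_ind else 1) * Z (?s \<circ> w1) w2 (z_ind \<circ> ?s) -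
         (if inv w2 i < inv w2 (Suc i) then t_ind else 1) * Z w1 (?s \<circ> w2) z_ind)"
      using partition_function_exchange[OF i w assms(5,6), of t_ind z_ind N lam]
      unfolding R1 R2 by (intro divided_difference_eq nz) (simp only: Z_def swap[unfolded Z_def])
    show ?thesis
      unfolding D1_def D2_def D3_def D4_def Suc_eq_plus1[symmetric]
      by (intro conjI impI; elim conjE)
         (use exchange in \<open>simp_all only: up down if_True if_False mult_1 simp_thms\<close>)
  qed
  show ?thesis
    using D_idempotent D_annihilate main by (simp add: Let_def)
qed

end
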